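(* Let $\phi_1: M_3(\mathbb{C})\to M_3(\mathbb{C})$ be a PPT map, let $\phi_2: M_3(\mathbb{C})\to M_3(\mathbb{C})$ be a completely positive map, and let $\rho\in M_n\otimes M_3$ be a bipartite state. If $(I_n\otimes\phi_2)(\rho)$ has Schmidt number at most two, then the state $(I_n\otimes(\phi_1\circ\phi_2))(\rho)$ is separable.
   Context: A linear map $\phi$ on $M_3(\mathbb{C})$ is a PPT map if it is both completely positive and completely copositive (both $\phi$ and $T\circ\phi$ are completely positive, $T$ the transpose). $I_n$ is the identity map on $M_n$. A positive semidefinite $\sigma\in M_n\otimes M_3$ has Schmidt number at most $k$ if it can be written as $\sigma=\sum_j p_j|a_j\rangle\langle a_j|$ with $p_j\ge0$ and each vector $|a_j\rangle\in\mathbb{C}^n\otimes\mathbb{C}^3$ of Schmidt rank at most $k$. A positive semidefinite matrix is separable if it is a nonnegative combination of products $\alpha\otimes\beta$ with $\alpha,\beta$ positive semidefinite. *)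

theory Defs
  imports "Jordan_Normal_Form.Matrix"
begin

text \<open>Conventions. Matrices are Jordan_Normal_Form complex matrices. The tensor product
  C^n (x) C^3 is identified with C^(3n) via (i,a) |-> 3*i + a (standard Kronecker ordering),
  and M_n (x) M_3 with (3n) x (3n) matrices accordingly.\<close>

definition psd :: "nat \<Rightarrow> complex mat \<Rightarrow> bool" where
  "psd N A \<longleftrightarrow> A \<in> carrier_mat N N
     \<and> (\<forall>i<N. \<forall>j<N. A $$ (i, j) = cnj (A $$ (j, i)))
     \<and> (\<forall>v \<in> carrier_vec N.
          let q = (\<Sum>i<N. \<Sum>j<N. cnj (v $ i) * A $$ (i, j) * v $ j) in Im q = 0 \<and> Re q \<ge> 0)"

definition kron_mat :: "complex mat \<Rightarrow> complex mat \<Rightarrow> complex mat" where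
  "kron_mat A B = mat (dim_row A * dim_row B) (dim_col A * dim_col B)
     (\<lambda>(r, c). A $$ (r div dim_row B, c div dim_col B) * B $$ (r mod dim_row B, c mod dim_col B))"

definition kron_vec :: "complex vec \<Rightarrow> complex vec \<Rightarrow> complex vec" where
  "kron_vec x y = vec (dim_vec x * dim_vec y) (\<lambda>r. x $ (r div dim_vec y) * y $ (r mod dim_vec y))"

definition outer :: "complex vec \<Rightarrow> complex mat" where
  "outer a = mat (dim_vec a) (dim_vec a) (\<lambda>(i, j). a $ i * cnj (a $ j))"

definition linear_map3 :: "(complex mat \<Rightarrow> complex mat) \<Rightarrow> bool" where
  "linear_map3 \<phi> \<longleftrightarrow>
     (\<forall>X \<in> carrier_mat 3 3. \<phi> X \<in> carrier_mat 3 3)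
   \<and> (\<forall>X \<in> carrier_mat 3 3. \<forall>Y \<in> carrier_mat 3 3. \<phi> (X + Y) = \<phi> X + \<phi> Y)
   \<and> (\<forall>X \<in> carrier_mat 3 3. \<forall>c. \<phi> (c \<cdot>\<^sub>m X) = c \<cdot>\<^sub>m \<phi> X)"

definition block3 :: "complex mat \<Rightarrow> nat \<Rightarrow> nat \<Rightarrow> complex mat" where
  "block3 X i j = mat 3 3 (\<lambda>(a, b). X $$ (3 * i + a, 3 * j + b))"

definition id_tensor :: "nat \<Rightarrow> (complex mat \<Rightarrow> complex mat) \<Rightarrow> complex mat \<Rightarrow> complex mat" where
  "id_tensor m \<phi> X = mat (m * 3) (m * 3)
     (\<lambda>(r, c). \<phi> (block3 X (r div 3) (c div 3)) $$ (r mod 3, c mod 3))"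

definition completely_positive :: "(complex mat \<Rightarrow> complex mat) \<Rightarrow> bool" where
  "completely_positive \<phi> \<longleftrightarrow> linear_map3 \<phi> \<and>
     (\<forall>m X. psd (m * 3) X \<longrightarrow> psd (m * 3) (id_tensor m \<phi> X))"

definition completely_copositive :: "(complex mat \<Rightarrow> complex mat) \<Rightarrow> bool" where
  "completely_copositive \<phi> \<longleftrightarrow> completely_positive (\<lambda>X. transpose_mat (\<phi> X))"

definition PPT_map :: "(complex mat \<Rightarrow> complex mat) \<Rightarrow> bool" where
  "PPT_map \<phi> \<longleftrightarrow> completely_positive \<phi> \<and> completely_copositive \<phi>"

definition schmidt_rank_le :: "nat \<Rightarrow> nat \<Rightarrow> nat \<Rightarrow> complex vec \<Rightarrow> bool" where
  "schmidt_rank_le n d k a \<longleftrightarrow> (\<exists>xs ys. length xs = length ys \<and> length xs \<le> k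
      \<and> set xs \<subseteq> carrier_vec n \<and> set ys \<subseteq> carrier_vec d
      \<and> a = vec (n * d) (\<lambda>r. \<Sum>j<length xs. kron_vec (xs ! j) (ys ! j) $ r))"

definition schmidt_number_le :: "nat \<Rightarrow> nat \<Rightarrow> nat \<Rightarrow> complex mat \<Rightarrow> bool" where
  "schmidt_number_le n d k \<sigma> \<longleftrightarrow> psd (n * d) \<sigma> \<and>
     (\<exists>ps as. length ps = length as \<and> (\<forall>p \<in> set ps. p \<ge> 0)
        \<and> (\<forall>a \<in> set as. a \<in> carrier_vec (n * d) \<and> schmidt_rank_le n d k a)
        \<and> \<sigma> = mat (n * d) (n * d) (\<lambda>rc. \<Sum>j<length as. (complex_of_real (ps ! j) \<cdot>\<^sub>m outer (as ! j)) $$ rc))"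

definition separable :: "nat \<Rightarrow> nat \<Rightarrow> complex mat \<Rightarrow> bool" where
  "separable n d \<sigma> \<longleftrightarrow> psd (n * d) \<sigma> \<and>
     (\<exists>\<alpha>s \<beta>s. length \<alpha>s = length \<beta>s \<and> (\<forall>\<alpha> \<in> set \<alpha>s. psd n \<alpha>) \<and> (\<forall>\<beta> \<in> set \<beta>s. psd d \<beta>)
        \<and> \<sigma> = mat (n * d) (n * d) (\<lambda>rc. \<Sum>j<length \<alpha>s. kron_mat (\<alpha>s ! j) (\<beta>s ! j) $$ rc))"

definition is_state :: "nat \<Rightarrow> complex mat \<Rightarrow> bool" where
  "is_state N \<rho> \<longleftrightarrow> psd N \<rho> \<and> (\<Sum>i<N. \<rho> $$ (i, i)) = 1"

end

theory Submission
  imports Defs "HOL-Analysis.Analysis" "HOL-Computational_Algebra.Fundamental_Theorem_Algebra"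
begin

text \<open>It suffices to treat a single vector of Schmidt rank at most two.  Applying a PPT map to its
  second factor gives, up to a local operator on the first factor, a PPT operator on
  \<open>C^2 \<otimes> C^3\<close>, so everything rests on the Stormer--Woronowicz theorem that such operators are
  separable.  By induction on the ranks of the operator and of its partial transpose it is enough
  to find a product vector \<open>e \<otimes> f\<close> in the range of the operator whose partial conjugate lies in
  the range of the partial transpose: subtracting a suitable multiple lowers one of the ranks.

  Write the operator as a block matrix with entries \<open>A, B, B*, C\<close>.  If \<open>A\<close> is singular there is
  such a product vector or the dimension drops.  Otherwise normalise \<open>A = 1\<close> and \<open>B = N\<close>; then
  \<open>R = C - N*N\<close> and \<open>S = C - NN*\<close> are positive with \<open>N*N - NN* = S - R\<close>, and one looks for
  \<open>f \<noteq> 0\<close> and \<open>z\<close> with \<open>(N* - z) f\<close> in the range of \<open>R\<close> and \<open>(N - cnj z) f\<close> in the range of \<open>S\<close>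
  (or, for \<open>z\<close> infinite, \<open>f\<close> in both ranges).  The two essential cases are:
  for ranks 1 and 2 the condition is the vanishing of a determinant of bidegree (2, 1) in \<open>z\<close> and
  \<open>cnj z\<close>, which has a zero by Brouwer's theorem;
  for ranks 1 and 1, say \<open>R = rr*\<close> and \<open>S = ss*\<close>, trace identities give \<open>|N r| = |N* s|\<close>, and this
  makes it possible to extend \<open>N\<close> to a normal operator in one more dimension, whose eigenvectors
  provide \<open>f\<close>.\<close>

section \<open>Linear algebra over the complex numbers\<close>

no_notation vec_index (infixl \<open>$\<close> 100)
no_notation scalar_prod (infix \<open>\<bullet>\<close> 70)

section \<open>Complex inner product, adjoints and rank-one matrices\<close>

definition cdot :: "complex^'n \<Rightarrow> complex^'n \<Rightarrow> complex" where
  "cdot x y = (\<Sum>i\<in>UNIV. cnj (x $ i) * y $ i)"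

definition cadj :: "complex^'n^'m \<Rightarrow> complex^'m^'n" where
  "cadj M = (\<chi> i j. cnj (M $ j $ i))"

definition dyad :: "complex^'n \<Rightarrow> complex^'m \<Rightarrow> complex^'m^'n" where
  "dyad r s = (\<chi> i j. r $ i * cnj (s $ j))"

lemma cdot_add_left: "cdot (x + y) z = cdot x z + cdot y z"
  and cdot_add_right: "cdot z (x + y) = cdot z x + cdot z y"
  and cdot_diff_left: "cdot (x - y) z = cdot x z - cdot y z"
  and cdot_diff_right: "cdot z (x - y) = cdot z x - cdot z y"
  and cdot_minus_left: "cdot (- x) z = - cdot x z"
  and cdot_minus_right: "cdot z (- x) = - cdot z x"
  and cdot_scale_left: "cdot (c *s x) z = cnj c * cdot x z"
  and cdot_scale_right: "cdot z (c *s x) = c * cdot z x"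
  and cdot_zero_left: "cdot 0 z = 0"
  and cdot_zero_right: "cdot z 0 = 0"
  by (simp_all add: cdot_def sum.distrib sum_subtractf sum_negf sum_distrib_left algebra_simps)

lemmas cdot_simps = cdot_add_left cdot_add_right cdot_diff_left cdot_diff_right cdot_minus_left
  cdot_minus_right cdot_scale_left cdot_scale_right cdot_zero_left cdot_zero_right

lemma cnj_cdot: "cnj (cdot x y) = cdot y x"
  by (simp add: cdot_def mult.commute)

text \<open>Links the sesquilinear form to the real inner product on \<open>complex^'n\<close>, so
  that facts about real quadratic forms apply to complex matrices.\<close>

lemma Re_cdot: "Re (cdot x y) = inner x y"
  by (simp add: cdot_def inner_vec_def inner_complex_def)

lemma cdot_self: "cdot x x = complex_of_real ((norm x)\<^sup>2)"
proof -
  have "Im (cdot x x) = 0"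
    by (simp add: cdot_def)
  then show ?thesis
    by (simp add: complex_eq_iff Re_cdot power2_norm_eq_inner)
qed

lemma cdot_self_eq_0 [simp]: "cdot x x = 0 \<longleftrightarrow> x = 0"
  by (simp add: cdot_self)

lemma cdot_eq_0_commute: "cdot x y = 0 \<longleftrightarrow> cdot y x = 0"
  by (metis cnj_cdot complex_cnj_zero_iff)

lemma cadj_cadj [simp]: "cadj (cadj M) = M"
  by (simp add: cadj_def vec_eq_iff)

lemma cadj_diff: "cadj (M - N) = cadj M - cadj N"
  and cadj_mat_1 [simp]: "cadj (mat 1) = mat 1"
  and cadj_0 [simp]: "cadj 0 = 0"
  by (simp_all add: cadj_def vec_eq_iff mat_def)

lemma cadj_mul: "cadj (M ** N) = cadj N ** cadj M"
  by (simp add: cadj_def vec_eq_iff matrix_matrix_mult_def mult.commute)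

lemma cdot_cadj_right: "cdot x (cadj M *v y) = cdot (M *v x) y"
proof -
  have "cdot x (cadj M *v y) = (\<Sum>i\<in>UNIV. \<Sum>j\<in>UNIV. cnj (x $ i) * cnj (M $ j $ i) * y $ j)"
    by (simp add: cdot_def cadj_def matrix_vector_mult_def sum_distrib_left mult.assoc)
  also have "\<dots> = (\<Sum>j\<in>UNIV. \<Sum>i\<in>UNIV. cnj (x $ i) * cnj (M $ j $ i) * y $ j)"
    by (rule sum.swap)
  also have "\<dots> = cdot (M *v x) y"
    by (simp add: cdot_def matrix_vector_mult_def sum_distrib_left sum_distrib_right mult_ac)
  finally show ?thesis .
qed

lemma cdot_cadj_left: "cdot (cadj M *v x) y = cdot x (M *v y)"
  by (metis cdot_cadj_right cadj_cadj)

lemma cdot_axis_left: "cdot (axis i 1) x = x $ i"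
  by (simp add: cdot_def axis_def if_distrib[of cnj] if_distrib[of "\<lambda>z. z * _"] cong: if_cong)

lemma matrix_vector_neg: "M *v (- x) = - (M *v x)" for M :: "complex^'n^'m"
  by (metis add.inverse_inverse add_eq_0_iff matrix_vector_mult_0_right matrix_vector_right_distrib)

lemma dyad_mult_vec: "dyad r s *v x = cdot s x *s r"
  by (simp add: dyad_def cdot_def matrix_vector_mult_def vec_eq_iff sum_distrib_left mult_ac)

lemma cadj_dyad: "cadj (dyad r s) = dyad s r"
  by (simp add: cadj_def dyad_def vec_eq_iff)

lemma trace_dyad: "trace (dyad r s) = cdot s r"
  by (simp add: trace_def dyad_def cdot_def mult.commute)

lemma mult_dyad: "M ** dyad r s = dyad (M *v r) s"
  by (simp add: dyad_def vec_eq_iff matrix_matrix_mult_def matrix_vector_mult_def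
      sum_distrib_left sum_distrib_right mult_ac)

lemma matrix_eqI: "(\<And>x. M *v x = N *v x) \<Longrightarrow> M = N" for M N :: "complex^'n^'m"
  by (simp add: matrix_eq)

section \<open>Positive semidefinite forms and matrices\<close>

lemma psd_form_cauchy_schwarz:
  fixes T :: "'a::real_inner \<Rightarrow> 'a"
  assumes T: "linear T" "\<And>u v. inner (T u) v = inner u (T v)" "\<And>u. 0 \<le> inner u (T u)"
  shows "(inner u (T v))\<^sup>2 \<le> inner u (T u) * inner v (T v)"
proof -
  define a b c where "a = inner u (T u)" and "b = inner u (T v)" and "c = inner v (T v)"
  have q: "0 \<le> a + 2 * b * t + c * t\<^sup>2" for t
  proof -
    have "inner (u + t *\<^sub>R v) (T (u + t *\<^sub>R v)) = a + 2 * b * t + c * t\<^sup>2"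
      using T(2)[of u v]
      by (simp add: linear_add[OF T(1)] linear_scale[OF T(1)] inner_add_left inner_add_right
          a_def b_def c_def power2_eq_square algebra_simps inner_commute)
    then show ?thesis using T(3) by metis
  qed
  have "c \<ge> 0" by (simp add: c_def T(3))
  have "b\<^sup>2 \<le> a * c"
  proof (cases "c = 0")
    case True
    have "b = 0"
    proof (rule ccontr)
      assume "b \<noteq> 0"
      \<comment> \<open>With \<open>c = 0\<close> the quadratic is affine in \<open>t\<close>, and
        at this \<open>t\<close> it equals -1.\<close>
      then show False using q[of "- (a + 1) / (2 * b)"] True by (simp add: field_simps)
    qed
    then show ?thesis by (simp add: True)
  next
    case False
    then have "c > 0" using \<open>c \<ge> 0\<close> by simp
    \<comment> \<open>\<open>t = - b / c\<close> is the minimiser of the quadratic.\<close>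
    have "a + 2 * b * (- b / c) + c * (- b / c)\<^sup>2 = a - b\<^sup>2 / c"
      using \<open>c > 0\<close> by (simp add: field_simps power2_eq_square)
    with q[of "- b / c"] have "b\<^sup>2 / c \<le> a" by simp
    then show ?thesis using \<open>c > 0\<close> by (simp add: field_simps)
  qed
  then show ?thesis by (simp add: a_def b_def c_def)
qed

text \<open>Cauchy-Schwarz with \<open>u = T v\<close> bounds the fourth power of the norm of
  \<open>T v\<close> by 0.\<close>

lemma psd_form_kernel:
  fixes T :: "'a::real_inner \<Rightarrow> 'a"
  assumes "linear T" "\<And>u v. inner (T u) v = inner u (T v)" "\<And>u. 0 \<le> inner u (T u)"
    and "inner v (T v) = 0"
  shows "T v = 0"
  using psd_form_cauchy_schwarz[OF assms(1-3), of "T v" v] assms(4) by simp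

definition hpsd :: "complex^'n^'n \<Rightarrow> bool" where
  "hpsd R \<longleftrightarrow> cadj R = R \<and> (\<forall>x. 0 \<le> Re (cdot x (R *v x)))"

lemma linear_mult_complex: "linear (\<lambda>x. M *v x)" for M :: "complex^'n^'m"
proof (rule linearI)
  show "M *v (t *\<^sub>R x) = t *\<^sub>R (M *v x)" for t and x
    by (simp add: vec_eq_iff matrix_vector_mult_def scaleR_sum_right)
qed (simp add: matrix_vector_right_distrib)

lemma hpsd_kernel:
  assumes "hpsd R" "Re (cdot x (R *v x)) = 0"
  shows "R *v x = 0"
proof (rule psd_form_kernel[where T="\<lambda>x. R *v x"])
  show "inner (R *v u) v = inner u (R *v v)" for u v
    using cdot_cadj_left[of R u v] assms(1) by (simp add: hpsd_def flip: Re_cdot)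
qed (use assms in \<open>auto simp: hpsd_def Re_cdot linear_mult_complex\<close>)

lemma hpsd_cdot: "hpsd R \<Longrightarrow> cdot (R *v x) y = cdot x (R *v y)"
  using cdot_cadj_left[of R x y] by (simp add: hpsd_def)

lemma hpsd_cdot_real: "hpsd R \<Longrightarrow> cdot x (R *v x) = complex_of_real (Re (cdot x (R *v x)))"
  using cnj_cdot[of x "R *v x"] hpsd_cdot[of R x x] by (simp add: complex_eq_iff)

text \<open>The diagonal entries are non-negative with sum 0, so each vanishes; then every basis
  vector lies in the kernel by \<open>hpsd_kernel\<close>.\<close>

lemma hpsd_trace_0:
  assumes "hpsd R" "trace R = 0"
  shows "R = 0"
proof -
  have col: "(R *v axis i 1) $ j = R $ j $ i" for i j
    by (simp add: matrix_vector_mult_def axis_def if_distrib[of "\<lambda>z. _ * z"] cong: if_cong)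
  have diag: "cdot (axis i 1) (R *v axis i 1) = R $ i $ i" for i
    by (simp add: cdot_axis_left col)
  have "(\<Sum>i\<in>UNIV. Re (R $ i $ i)) = 0"
    using assms(2) by (simp add: trace_def flip: Re_sum)
  moreover have nn: "0 \<le> Re (R $ i $ i)" for i
    using assms(1) by (simp add: hpsd_def flip: diag)
  ultimately have "Re (R $ i $ i) = 0" for i
    by (simp add: sum_nonneg_eq_0_iff)
  then have "R *v axis i 1 = 0" for i
    by (intro hpsd_kernel[OF assms(1)]) (simp add: diag)
  then show ?thesis
    by (simp add: vec_eq_iff flip: col)
qed

section \<open>Eigenvectors of complex matrices and of normal matrices\<close>

lemma singular_kernel:
  fixes M :: "complex^'n^'n"
  assumes "det M = 0"
  obtains x where "x \<noteq> 0" "M *v x = 0"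
  using assms invertible_det_nz[of M] matrix_left_invertible_ker[of M] invertible_left_inverse[of M]
  by blast

lemma mat_mult_component: "(mat c ** M) $ i $ j = c * M $ i $ j"
  by (simp add: matrix_matrix_mult_def mat_def if_distrib[of "\<lambda>x. x * _"] cong: if_cong)

lemma mat_mult_vec: "mat c *v x = c *s x"
  by (simp add: vec_eq_iff matrix_vector_mult_def mat_def if_distrib[of "\<lambda>x. x * _"] cong: if_cong)

lemma det_mat_mult: "det (mat c ** M) = c ^ CARD('n) * det M" for M :: "complex^'n^'n"
  by (simp add: det_mul det_diagonal mat_def)

lemma poly_det: "poly (det P) z = det (\<chi> i j. poly (P $ i $ j) z)" for P :: "complex poly^'n^'n"
  by (simp add: det_def poly_sum poly_prod)

text \<open>The fundamental theorem of algebra gives a root of the characteristic polynomial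
  \<open>P\<close>, once \<open>P\<close> is known to be non-constant.\<close>

lemma eigenvector_exists:
  fixes M :: "complex^'n^'n"
  obtains v l where "v \<noteq> 0" "M *v v = l *s v"
proof -
  define P where "P = det (\<chi> i j. [:M $ i $ j:] - (if i = j then [:0,1:] else 0))"
  have P: "poly P z = det (M - mat z)" for z
    unfolding P_def poly_det
    by (rule arg_cong[of _ _ det]) (simp add: vec_eq_iff mat_def)
  have "\<exists>z. poly P z = 0"
  proof (rule ccontr)
    assume no: "\<nexists>z. poly P z = 0"
    then have "constant (poly P)" using fundamental_theorem_of_algebra by blast
    then have c: "poly P z = poly P 0" for z by (simp add: constant_def)
    \<comment> \<open>The reversed characteristic polynomial. If \<open>P\<close> were constant,
      \<open>Q w\<close> would be a constant times a positive power of \<open>- w\<close> for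
      \<open>w\<close> non-zero and so tend to 0 at 0, whereas \<open>Q\<close> at 0 is
      \<open>det (mat 1)\<close>.\<close>
    define Q where "Q = det (\<chi> i j. (if i = j then [:1:] else 0) - [:0, M $ i $ j:])"
    have Q: "poly Q w = det (mat 1 - mat w ** M)" for w
      unfolding Q_def poly_det
      by (rule arg_cong[of _ _ det]) (simp add: vec_eq_iff mat_mult_component, simp add: mat_def)
    have ev: "poly Q w = (- w) ^ CARD('n) * poly P 0" if "w \<noteq> 0" for w
    proof -
      have "mat 1 - mat w ** M = mat (- w) ** (M - mat (1/w))"
        using that by (simp add: vec_eq_iff mat_mult_component) (simp add: mat_def algebra_simps)
      then have "poly Q w = (- w) ^ CARD('n) * poly P (1/w)"
        by (simp add: Q P det_mat_mult)
      then show ?thesis using c by metis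
    qed
    have lim: "((\<lambda>w. poly Q w) \<longlongrightarrow> poly Q 0) (at 0)"
      by (intro tendsto_intros)
    have "((\<lambda>w. (- w) ^ CARD('n) * poly P 0) \<longlongrightarrow> (- 0) ^ CARD('n) * poly P 0) (at 0)"
      by (intro tendsto_intros)
    moreover have "eventually (\<lambda>w. poly Q w = (- w) ^ CARD('n) * poly P 0) (at 0)"
      using ev by (simp add: eventually_at_filter)
    ultimately have "((\<lambda>w. poly Q w) \<longlongrightarrow> (- 0) ^ CARD('n) * poly P 0) (at 0)"
      by (simp only: tendsto_cong)
    with lim have "poly Q 0 = (- 0) ^ CARD('n) * poly P 0"
      by (rule LIM_unique)
    moreover have "mat 0 ** M = 0"
      by (simp add: vec_eq_iff mat_mult_component)
    ultimately show False by (simp add: Q power_0_left)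
  qed
  then obtain z where "det (M - mat z) = 0" using P by auto
  then obtain v where v: "v \<noteq> 0" "(M - mat z) *v v = 0" by (rule singular_kernel)
  then have "M *v v = z *s v"
    using v(2) by (simp add: matrix_vector_mult_diff_rdistrib mat_mult_vec)
  then show ?thesis using v(1) that by blast
qed

text \<open>Normality makes \<open>cadj M *v v\<close> as long as \<open>M *v v\<close>; expanding
  the squared norm of the difference \<open>w\<close> of the two sides then gives 0.\<close>

lemma normal_eigenvector:
  assumes "cadj M ** M = M ** cadj M" "M *v v = l *s v"
  shows "cadj M *v v = cnj l *s v"
proof -
  have mm: "cadj M *v (M *v v) = M *v (cadj M *v v)"
    using assms(1) by (simp add: matrix_vector_mul_assoc)
  define w where "w = cadj M *v v - cnj l *s v"
  have 1: "cdot (cadj M *v v) (cadj M *v v) = l * cnj l * cdot v v"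
    by (simp only: cdot_cadj_left mm[symmetric]) (simp only: cdot_cadj_right assms(2) cdot_simps mult_ac)
  have 2: "cdot (cadj M *v v) v = l * cdot v v" "cdot v (cadj M *v v) = cnj l * cdot v v"
    by (simp_all only: cdot_cadj_left cdot_cadj_right assms(2) cdot_simps)
  have "cdot w w = 0"
    by (simp add: w_def cdot_simps 1 2 algebra_simps)
  then show ?thesis by (simp add: w_def)
qed

section \<open>Removing product vectors\<close>

lemma matrix_vector_scaleR: "M *v (t *\<^sub>R x) = t *\<^sub>R (M *v x)" for M :: "complex^'n^'m"
  by (rule linear_scale[OF linear_mult_complex])

text \<open>The operator on pairs with blocks \<open>A, B, B*, C\<close>; its partial transpose is \<open>bop A (cadj B) C\<close>.\<close>

definition bop :: "complex^'n^'n \<Rightarrow> complex^'n^'n \<Rightarrow> complex^'n^'n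
    \<Rightarrow> (complex^'n) \<times> (complex^'n) \<Rightarrow> (complex^'n) \<times> (complex^'n)" where
  "bop A B C w = (A *v fst w + B *v snd w, cadj B *v fst w + C *v snd w)"

definition ppt :: "complex^'n^'n \<Rightarrow> complex^'n^'n \<Rightarrow> complex^'n^'n \<Rightarrow> bool" where
  "ppt A B C \<longleftrightarrow> cadj A = A \<and> cadj C = C
     \<and> (\<forall>w. 0 \<le> inner w (bop A B C w)) \<and> (\<forall>w. 0 \<le> inner w (bop A (cadj B) C w))"

text \<open>With \<open>e = (a, b)\<close>: the vector \<open>e \<otimes> f\<close> is in the range of the operator and
  \<open>cnj e \<otimes> f\<close> in the range of its partial transpose.\<close>

definition prodvec :: "complex^'n^'n \<Rightarrow> complex^'n^'n \<Rightarrow> complex^'n^'n \<Rightarrow> bool" where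
  "prodvec A B C \<longleftrightarrow> (\<exists>a b f u u'. (a, b) \<noteq> (0, 0) \<and> f \<noteq> 0
     \<and> bop A B C u = (a *s f, b *s f) \<and> bop A (cadj B) C u' = (cnj a *s f, cnj b *s f))"

text \<open>Each step adds the blocks of the projector-like product of \<open>e = (a, b)\<close> and
  \<open>f\<close>, that is \<open>dyad e e\<close> tensored with \<open>dyad f f\<close>.\<close>

inductive sep :: "complex^'n^'n \<Rightarrow> complex^'n^'n \<Rightarrow> complex^'n^'n \<Rightarrow> bool" where
  sep_zero: "sep 0 0 0"
| sep_add: "sep A B C \<Longrightarrow> sep (A + dyad (a *s f) (a *s f)) (B + dyad (a *s f) (b *s f)) (C + dyad (b *s f) (b *s f))"

section \<open>Subtracting a rank-one term from a positive block operator\<close>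

lemma linear_bop: "linear (bop A B C)"
proof (rule linearI)
  show "bop A B C (t *\<^sub>R w) = t *\<^sub>R bop A B C w" for t w
    by (simp add: bop_def prod_eq_iff scaleR_add_right matrix_vector_scaleR)
qed (simp add: bop_def matrix_vector_right_distrib)

lemma inner_bop_pair: "inner v (bop A B C w) = Re (cdot (fst v) (A *v fst w) + cdot (fst v) (B *v snd w)
    + cdot (snd v) (cadj B *v fst w) + cdot (snd v) (C *v snd w))"
  by (simp add: bop_def inner_prod_def inner_add_right Re_cdot)

lemma bop_self_adjoint:
  assumes "cadj A = A" "cadj C = C"
  shows "inner (bop A B C v) w = inner v (bop A B C w)"
proof -
  have AC: "cdot x (A *v y) = cdot (A *v x) y" "cdot x (C *v y) = cdot (C *v x) y" for x y
    using cdot_cadj_right[of x A y] cdot_cadj_right[of x C y] assms by auto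
  have "inner (bop A B C v) w = inner w (bop A B C v)"
    by (rule inner_commute)
  also have "\<dots> = inner v (bop A B C w)"
    unfolding inner_bop_pair
    by (subst (2) cnj_cdot[symmetric], subst (3) cnj_cdot[symmetric], subst (4) cnj_cdot[symmetric],
        subst cnj_cdot[symmetric]) (simp add: AC cdot_cadj_right cdot_cadj_left)
  finally show ?thesis .
qed

lemma bop_scale: "bop A B C (c *s x, c *s y) = (c *s fst (bop A B C (x, y)), c *s snd (bop A B C (x, y)))"
  by (simp add: bop_def vec.scale vec.scale_right_distrib)

lemma bop_sub_dyad:
  "bop (A - dyad p p) (B - dyad p q) (C - dyad q q) w
     = bop A B C w - ((cdot p (fst w) + cdot q (snd w)) *s p, (cdot p (fst w) + cdot q (snd w)) *s q)"
  by (simp add: bop_def cadj_diff cadj_dyad matrix_vector_mult_diff_rdistrib dyad_mult_vec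
      vec.scale_left_distrib)

text \<open>For a vector \<open>(p, q)\<close> in the range with preimage \<open>u\<close>, the
  operator minus \<open>s^2\<close> times the rank-one form of \<open>(p, q)\<close> stays positive
  as long as \<open>s^2 * inner u (bop A B C u)\<close> is at most 1. At equality \<open>u\<close>
  joins the kernel.\<close>

locale sub_step =
  fixes A B C :: "complex^'n^'n" and u :: "(complex^'n) \<times> (complex^'n)" and p q :: "complex^'n"
    and s :: real
  assumes herm: "cadj A = A" "cadj C = C"
    and pos: "\<And>w. 0 \<le> inner w (bop A B C w)"
    and u: "bop A B C u = (p, q)"
begin

abbreviation "sub \<equiv> bop (A - dyad (of_real s *s p) (of_real s *s p))
  (B - dyad (of_real s *s p) (of_real s *s q)) (C - dyad (of_real s *s q) (of_real s *s q))"

lemma sub_eq: "sub w = bop A B C w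
    - s\<^sup>2 *\<^sub>R ((cdot p (fst w) + cdot q (snd w)) *s p, (cdot p (fst w) + cdot q (snd w)) *s q)"
  unfolding bop_sub_dyad
  by (simp add: cdot_simps vec_eq_iff power2_eq_square algebra_simps scaleR_conv_of_real[where 'a=complex])

lemma pairing: "inner u (bop A B C w) = Re (cdot p (fst w) + cdot q (snd w))"
  using bop_self_adjoint[OF herm, where B=B and v=u and w=w] by (simp add: u inner_prod_def Re_cdot)

lemma cauchy: "(cmod (cdot p (fst w) + cdot q (snd w)))\<^sup>2 \<le> inner u (bop A B C u) * inner w (bop A B C w)"
proof -
  define z where "z = cdot p (fst w) + cdot q (snd w)"
  \<comment> \<open>The real Cauchy-Schwarz inequality only sees a real part; multiplying
    \<open>w\<close> by this phase makes the pairing equal to its modulus.\<close>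
  define c where "c = (if z = 0 then 1 else cnj z / cmod z)"
  have "cmod c = 1"
    by (simp add: c_def norm_divide)
  then have c: "c * z = cmod z" "cnj c * c = 1"
    using complex_norm_square[of c] complex_norm_square[of z]
    by (auto simp: c_def mult.commute power2_eq_square nonzero_divide_eq_eq)
  define w' where "w' = (c *s fst w, c *s snd w)"
  have "inner u (bop A B C w') = cmod z"
    unfolding pairing using c(1) by (simp add: w'_def cdot_simps z_def distrib_left[symmetric])
  moreover have "inner w' (bop A B C w') = inner w (bop A B C w)"
  proof -
    have *: "cdot (c *s x) (c *s y) = cdot x y" for x y :: "complex^'n"
      using c(2) by (simp add: cdot_simps mult.assoc[symmetric] mult.commute)
    show ?thesis
      using bop_scale[of A B C c "fst w" "snd w"] by (simp add: w'_def inner_prod_def * flip: Re_cdot)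
  qed
  ultimately show ?thesis
    using psd_form_cauchy_schwarz[OF linear_bop bop_self_adjoint[OF herm] pos, where u=u and v=w']
    by (simp add: z_def)
qed

lemma sub_pos:
  assumes "s\<^sup>2 * inner u (bop A B C u) \<le> 1"
  shows "0 \<le> inner w (sub w)"
proof -
  define z where "z = cdot p (fst w) + cdot q (snd w)"
  have "inner w (z *s p, z *s q) = Re (z * (cdot (fst w) p + cdot (snd w) q))"
    by (simp add: inner_prod_def cdot_simps distrib_left flip: Re_cdot)
  also have "cdot (fst w) p + cdot (snd w) q = cnj z"
    by (simp add: z_def cnj_cdot)
  also have "Re (z * cnj z) = (cmod z)\<^sup>2"
    by (simp flip: complex_norm_square)
  finally have eq: "inner w (sub w) = inner w (bop A B C w) - s\<^sup>2 * (cmod z)\<^sup>2"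
    by (simp only: sub_eq inner_diff_right inner_scaleR_right flip: z_def)
  have "s\<^sup>2 * (cmod z)\<^sup>2 \<le> s\<^sup>2 * (inner u (bop A B C u) * inner w (bop A B C w))"
    unfolding z_def by (intro mult_left_mono cauchy) simp
  also have "\<dots> \<le> 1 * inner w (bop A B C w)"
    using mult_right_mono[OF assms pos[of w]] by (simp add: mult.assoc)
  finally show ?thesis by (simp add: eq)
qed

text \<open>By \<open>cauchy\<close> a kernel vector pairs to 0 with \<open>(p, q)\<close>, so the
  subtracted term kills it too.\<close>

lemma sub_kernel:
  assumes "bop A B C w = 0"
  shows "sub w = 0"
proof -
  have "(cmod (cdot p (fst w) + cdot q (snd w)))\<^sup>2 \<le> 0"
    using cauchy[of w] assms by simp
  then show ?thesis by (simp add: sub_eq assms zero_prod_def)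
qed

lemma sub_kernel_u:
  assumes "s\<^sup>2 * inner u (bop A B C u) = 1"
  shows "sub u = 0"
proof -
  \<comment> \<open>\<open>pairing\<close> only gives the real part; self-adjointness makes the
    imaginary part vanish.\<close>
  have real: "cdot p (fst u) + cdot q (snd u) = of_real (inner u (bop A B C u))"
  proof -
    have *: "Im (cdot (M *v x) x) = 0" if "cadj M = M" for x and M :: "complex^'n^'n"
      using cnj_cdot[of x "M *v x"] cdot_cadj_left[of M x x] that by (simp add: complex_eq_iff)
    have "cdot (B *v snd u) (fst u) = cnj (cdot (cadj B *v fst u) (snd u))"
      by (simp add: cnj_cdot cdot_cadj_right)
    moreover have "p = A *v fst u + B *v snd u" "q = cadj B *v fst u + C *v snd u"
      using u by (simp_all add: bop_def)
    ultimately have "Im (cdot p (fst u) + cdot q (snd u)) = 0"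
      using *[OF herm(1), of "fst u"] *[OF herm(2), of "snd u"] by (simp add: cdot_simps)
    then show ?thesis by (simp add: pairing complex_eq_iff)
  qed
  have *: "of_real t *s x = t *\<^sub>R x" for t and x :: "complex^'n"
    by (simp add: vec_eq_iff scaleR_conv_of_real[where 'a=complex])
  have "sub u = (p, q) - (s\<^sup>2 * inner u (bop A B C u)) *\<^sub>R (p, q)"
    by (subst sub_eq) (simp add: real * u)
  then show ?thesis using assms by simp
qed

end

lemma dim_kernel_less:
  fixes T S :: "'a::euclidean_space \<Rightarrow> 'a"
  assumes "linear T" "linear S" "\<And>w. T w = 0 \<Longrightarrow> S w = 0" "S u = 0" "T u \<noteq> 0"
  shows "dim {w. T w = 0} < dim {w. S w = 0}"
proof (rule dim_psubset)
  have "span {w. T w = 0} = {w. T w = 0}" "span {w. S w = 0} = {w. S w = 0}"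
    by (simp_all add: linear_subspace_kernel span_eq_iff assms(1,2))
  then show "span {w. T w = 0} \<subset> span {w. S w = 0}"
    using assms(3-5) by (simp only:) blast
qed

text \<open>Induction on the sum of the real ranks of the operator and of its partial transpose,
  expressed through kernel dimensions. Each product vector allows a subtraction that lowers one rank
  and raises neither.\<close>

lemma sep_of_prodvec:
  fixes A B C :: "complex^'n^'n"
  assumes pv: "\<And>A B C :: complex^'n^'n. ppt A B C \<Longrightarrow> (A, B, C) \<noteq> (0, 0, 0) \<Longrightarrow> prodvec A B C"
    and "ppt A B C"
  shows "sep A B C"
  using assms(2)
proof (induction "2 * DIM((complex^'n) \<times> (complex^'n)) - dim {w. bop A B C w = 0}
    - dim {w. bop A (cadj B) C w = 0}" arbitrary: A B C rule: less_induct)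
  case less
  show ?case
  proof (cases "(A, B, C) = (0, 0, 0)")
    case True
    then show ?thesis by (simp add: sep_zero)
  next
    case False
    with pv[OF less.prems] obtain a b f u u' where ab: "(a, b) \<noteq> (0, 0)" "f \<noteq> 0"
      and u: "bop A B C u = (a *s f, b *s f)" and u': "bop A (cadj B) C u' = (cnj a *s f, cnj b *s f)"
      unfolding prodvec_def by blast
    have herm: "cadj A = A" "cadj C = C" and pos: "\<And>w. 0 \<le> inner w (bop A B C w)"
      and pos': "\<And>w. 0 \<le> inner w (bop A (cadj B) C w)"
      using less.prems by (auto simp: ppt_def)
    define m m' where "m = inner u (bop A B C u)" and "m' = inner u' (bop A (cadj B) C u')"
    have nz: "bop A B C u \<noteq> 0" "bop A (cadj B) C u' \<noteq> 0"
      using ab by (auto simp: u u' zero_prod_def)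
    have "m \<noteq> 0" "m' \<noteq> 0"
      using nz psd_form_kernel[where T="bop A B C" and v=u, OF linear_bop bop_self_adjoint[OF herm] pos]
        psd_form_kernel[where T="bop A (cadj B) C" and v=u', OF linear_bop bop_self_adjoint[OF herm] pos'] unfolding m_def m'_def by blast+
    then have m: "m > 0" "m' > 0" using pos[of u] pos'[of u'] by (auto simp: m_def m'_def)
    \<comment> \<open>The largest factor that keeps both operators positive; the one with the larger
      of \<open>m\<close> and \<open>m'\<close> gains a kernel vector.\<close>
    define s where "s = 1 / sqrt (max m m')"
    have s: "s\<^sup>2 = 1 / max m m'" using m by (simp add: s_def power_divide)
    interpret X: sub_step A B C u "a *s f" "b *s f" s
      by unfold_locales (use herm pos u in auto)
    interpret Y: sub_step A "cadj B" C u' "cnj a *s f" "cnj b *s f" s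
      by unfold_locales (use herm pos' u' in auto)
    define g where "g = of_real s *s f"
    define A' B' C' where "A' = A - dyad (a *s g) (a *s g)" and "B' = B - dyad (a *s g) (b *s g)"
      and "C' = C - dyad (b *s g) (b *s g)"
    have X: "X.sub = bop A' B' C'"
      by (simp add: A'_def B'_def C'_def g_def vector_smult_assoc mult.commute)
    \<comment> \<open>Conjugating \<open>e\<close> transposes its rank-one matrix, so one
      subtraction is compatible with the partial transpose.\<close>
    have swap: "dyad (cnj x *s g) (cnj y *s g) = dyad (y *s g) (x *s g)" for x y
      by (simp add: dyad_def vec_eq_iff mult_ac)
    have Y: "Y.sub = bop A' (cadj B') C'"
      using swap[of a a] swap[of a b] swap[of b b]
      by (simp add: A'_def B'_def C'_def g_def vector_smult_assoc mult.commute cadj_diff cadj_dyad)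
    have le: "s\<^sup>2 * m \<le> 1" "s\<^sup>2 * m' \<le> 1" using m by (auto simp: s field_simps)
    have "ppt A' B' C'"
      using X.sub_pos Y.sub_pos le herm
      unfolding ppt_def X[symmetric] Y[symmetric] by (auto simp: m_def m'_def A'_def C'_def cadj_diff cadj_dyad)
    have sub: "{w. bop A B C w = 0} \<subseteq> {w. bop A' B' C' w = 0}"
        "{w. bop A (cadj B) C w = 0} \<subseteq> {w. bop A' (cadj B') C' w = 0}"
      using X.sub_kernel Y.sub_kernel unfolding X Y by auto
    \<comment> \<open>These bounds ensure that the truncated subtractions in the measure do not hide
      the decrease.\<close>
    have bd: "dim {w. bop A' B' C' w = 0} \<le> DIM((complex^'n) \<times> (complex^'n))"
      "dim {w. bop A' (cadj B') C' w = 0} \<le> DIM((complex^'n) \<times> (complex^'n))"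
      by (rule dim_subset_UNIV)+
    have le2: "dim {w. bop A B C w = 0} \<le> dim {w. bop A' B' C' w = 0}"
      "dim {w. bop A (cadj B) C w = 0} \<le> dim {w. bop A' (cadj B') C' w = 0}"
      using sub by (simp_all add: dim_subset)
    have "dim {w. bop A B C w = 0} < dim {w. bop A' B' C' w = 0} \<or>
      dim {w. bop A (cadj B) C w = 0} < dim {w. bop A' (cadj B') C' w = 0}"
    proof (cases "m' \<le> m")
      case True
      then have "s\<^sup>2 * m = 1" using m by (simp add: s max_def)
      then have "X.sub u = 0" using X.sub_kernel_u by (simp add: m_def)
      then show ?thesis
        using dim_kernel_less[OF linear_bop linear_bop X.sub_kernel[unfolded X], where u=u] nz
        unfolding X by blast
    next
      case False
      then have "s\<^sup>2 * m' = 1" using m by (simp add: s max_def)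
      then have "Y.sub u' = 0" using Y.sub_kernel_u by (simp add: m'_def)
      then show ?thesis
        using dim_kernel_less[OF linear_bop linear_bop Y.sub_kernel[unfolded Y], where u=u'] nz
        unfolding Y by blast
    qed
    then have "sep A' B' C'"
      using bd le2 by (intro less.hyps \<open>ppt A' B' C'\<close>) linarith
    from sep_add[OF this, of a g b] show ?thesis
      by (simp add: A'_def B'_def C'_def)
  qed
qed

section \<open>Reduction to an identity block\<close>

lemma prodvec_cadj: "prodvec A B C \<Longrightarrow> prodvec A (cadj B) C"
  unfolding prodvec_def
  apply (elim exE)
  subgoal for a b f u u'
    by (rule exI[of _ "cnj a"], rule exI[of _ "cnj b"], rule exI[of _ f], rule exI[of _ u'], rule exI[of _ u])
      auto
  done

lemma ppt_cadj: "ppt A B C \<Longrightarrow> ppt A (cadj B) C"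
  by (auto simp: ppt_def)

lemma bop_cong: "bop (cadj G ** A ** G) (cadj G ** B ** G) (cadj G ** C ** G) (x, y)
    = map_prod (\<lambda>z. cadj G *v z) (\<lambda>z. cadj G *v z) (bop A B C (G *v x, G *v y))"
  by (simp add: bop_def cadj_mul matrix_vector_right_distrib flip: matrix_vector_mul_assoc)

lemma ppt_cong:
  fixes G :: "complex^'m^'n"
  assumes "ppt A B C"
  shows "ppt (cadj G ** A ** G) (cadj G ** B ** G) (cadj G ** C ** G)"
proof -
  have pos: "0 \<le> inner w (bop (cadj G ** A ** G) (cadj G ** B' ** G) (cadj G ** C ** G) w)"
    if "\<And>w. 0 \<le> inner w (bop A B' C w)" for B' w
  proof -
    have "inner w (bop (cadj G ** A ** G) (cadj G ** B' ** G) (cadj G ** C ** G) w)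
        = inner (G *v fst w, G *v snd w) (bop A B' C (G *v fst w, G *v snd w))"
      using bop_cong[of G A B' C "fst w" "snd w"]
      by (simp add: inner_prod_def cdot_cadj_right flip: Re_cdot)
    then show ?thesis using that by simp
  qed
  have eq: "cadj (cadj G ** B ** G) = cadj G ** cadj B ** G"
    by (simp add: cadj_mul matrix_mul_assoc)
  have "cadj A = A" "cadj C = C" and p: "\<And>w. 0 \<le> inner w (bop A B C w)"
    and p': "\<And>w. 0 \<le> inner w (bop A (cadj B) C w)"
    using assms by (auto simp: ppt_def)
  with pos[OF p] pos[OF p'] show ?thesis
    unfolding ppt_def eq by (auto simp: cadj_mul matrix_mul_assoc)
qed

text \<open>Pulling back along the surjection \<open>D\<close>: preimages are carried over by
  \<open>E\<close>, and \<open>cadj D *v f\<close> is non-zero because \<open>cadj E\<close> inverts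
  \<open>cadj D\<close> from the left.\<close>

lemma prodvec_lift:
  fixes D :: "complex^'n^'m" and E :: "complex^'m^'n"
  assumes "D ** E = mat 1" and "prodvec A B C"
  shows "prodvec (cadj D ** A ** D) (cadj D ** B ** D) (cadj D ** C ** D)"
proof -
  obtain a b f u u' where ab: "(a, b) \<noteq> (0, 0)" "f \<noteq> 0"
    and u: "bop A B C u = (a *s f, b *s f)" and u': "bop A (cadj B) C u' = (cnj a *s f, cnj b *s f)"
    using assms(2) unfolding prodvec_def by blast
  have DE: "D *v (E *v x) = x" for x
    by (simp add: matrix_vector_mul_assoc assms(1))
  have eq: "cadj (cadj D ** B ** D) = cadj D ** cadj B ** D"
    by (simp add: cadj_mul matrix_mul_assoc)
  have lift: "bop (cadj D ** A ** D) (cadj D ** B' ** D) (cadj D ** C ** D) (E *v fst w, E *v snd w)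
      = (p *s (cadj D *v f), q *s (cadj D *v f))" if "bop A B' C w = (p *s f, q *s f)" for B' w p q
    using that by (simp add: bop_cong DE vec.scale)
  have "cadj E *v (cadj D *v f) = f"
    by (simp add: matrix_vector_mul_assoc assms(1) flip: cadj_mul)
  then have "cadj D *v f \<noteq> 0"
    using ab(2) by auto
  with ab(1) lift[OF u] lift[OF u', folded eq] show ?thesis
    unfolding prodvec_def by blast
qed

lemma cdot_sum_right: "cdot x (sum f S) = (\<Sum>i\<in>S. cdot x (f i))"
  by (induction S rule: infinite_finite_induct) (simp_all add: cdot_simps)

lemma matrix_vector_sum: "M *v sum f S = (\<Sum>i\<in>S. M *v f i)" for M :: "complex^'n^'m"
  by (rule linear_sum[OF linear_mult_complex])

lemma matrix_axis_component: "(M *v axis i 1) $ j = M $ j $ i" for M :: "complex^'n^'m"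
  by (simp add: matrix_vector_mult_def axis_def if_distrib[of "\<lambda>z. _ * z"] cong: if_cong)

text \<open>Gram-Schmidt for the inner product defined by \<open>A\<close>, applied to the basis
  vectors. The support condition keeps coordinate \<open>j\<close> of the new vector
  \<open>v\<close> equal to 1, hence \<open>v\<close> non-zero.\<close>

lemma gram_schmidt_form:
  fixes A :: "complex^'n^'n"
  assumes A: "hpsd A" and pos: "\<And>x. x \<noteq> 0 \<Longrightarrow> A *v x \<noteq> 0"
  shows "\<exists>g :: 'n \<Rightarrow> complex^'n. (\<forall>i\<in>S. \<forall>j\<in>S. cdot (g i) (A *v g j) = (if i = j then 1 else 0))
    \<and> (\<forall>i\<in>S. \<forall>k. k \<notin> S \<longrightarrow> g i $ k = 0)"
proof (induction S rule: finite_induct[OF finite])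
  case 1
  then show ?case by simp
next
  case (2 j S)
  then obtain g where g: "\<And>i k. i \<in> S \<Longrightarrow> k \<in> S \<Longrightarrow> cdot (g i) (A *v g k) = (if i = k then 1 else 0)"
    and supp: "\<And>i k. i \<in> S \<Longrightarrow> k \<notin> S \<Longrightarrow> g i $ k = 0"
    by blast
  define v where "v = axis j 1 - (\<Sum>i\<in>S. cdot (g i) (A *v axis j 1) *s g i)"
  have orth: "cdot (g i) (A *v v) = 0" if "i \<in> S" for i
    using that 2 by (simp add: v_def matrix_vector_mult_diff_distrib cdot_simps cdot_sum_right
        matrix_vector_sum vec.scale g if_distrib[of "\<lambda>z. _ * z"] cong: if_cong)
  have v: "v $ k = axis j 1 $ k" if "k \<notin> S" for k
    using that by (simp add: v_def supp)
  have "v $ j = 1" using v[of j] 2 by simp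
  then have "v \<noteq> 0" by auto
  define m where "m = Re (cdot v (A *v v))"
  have m: "cdot v (A *v v) = of_real m"
    unfolding m_def by (rule hpsd_cdot_real[OF A])
  have "m \<noteq> 0" using hpsd_kernel[OF A, of v] pos[OF \<open>v \<noteq> 0\<close>] by (auto simp: m_def)
  moreover have "m \<ge> 0" using A by (simp add: hpsd_def m_def)
  ultimately have "m > 0" by simp
  define w where "w = of_real (1 / sqrt m) *s v"
  have ww: "cdot w (A *v w) = 1"
    using \<open>m > 0\<close> by (simp add: w_def vec.scale cdot_simps m flip: of_real_mult)
  have gw: "cdot (g i) (A *v w) = 0" "cdot w (A *v g i) = 0" if "i \<in> S" for i
    using orth[OF that] hpsd_cdot[OF A, of v "g i"] cnj_cdot[of "g i" "A *v v"]
    by (simp_all add: w_def vec.scale cdot_simps)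
  have w: "w $ k = 0" if "k \<notin> insert j S" for k
    using v[of k] that by (simp add: w_def axis_def)
  show ?case
  proof (intro exI[of _ "g(j := w)"] conjI ballI allI impI)
    fix i k assume "i \<in> insert j S" "k \<in> insert j S"
    then show "cdot ((g(j := w)) i) (A *v (g(j := w)) k) = (if i = k then 1 else 0)"
      using g gw ww \<open>j \<notin> S\<close> by auto
  next
    fix i k assume "i \<in> insert j S" "k \<notin> insert j S"
    then show "(g(j := w)) i $ k = 0"
      using supp w by auto
  qed
qed

text \<open>A matrix \<open>G\<close> with \<open>A\<close>-orthonormal columns turns
  \<open>A\<close> into the identity; its inverse \<open>H\<close> carries the product vector
  back.\<close>

lemma prodvec_posdef:
  fixes A B C :: "complex^'n^'n"
  assumes id: "\<And>N C :: complex^'n^'n. ppt (mat 1) N C \<Longrightarrow> prodvec (mat 1) N C"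
    and ABC: "ppt A B C" and A: "hpsd A" and pos: "\<And>x. x \<noteq> 0 \<Longrightarrow> A *v x \<noteq> 0"
  shows "prodvec A B C"
proof -
  obtain g :: "'n \<Rightarrow> complex^'n" where g: "\<And>i j. cdot (g i) (A *v g j) = (if i = j then 1 else 0)"
    using gram_schmidt_form[OF A pos, of UNIV] by auto
  define G :: "complex^'n^'n" where "G = (\<chi> k i. g i $ k)"
  have G: "G *v axis i 1 = g i" for i
    by (simp add: vec_eq_iff matrix_axis_component) (simp add: G_def)
  have "(cadj G ** A ** G) $ i $ j = (mat 1 :: complex^'n^'n) $ i $ j" for i j
  proof -
    have "(cadj G ** A ** G) $ i $ j = cdot (axis i 1) ((cadj G ** A ** G) *v axis j 1)"
      by (simp add: cdot_axis_left matrix_axis_component)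
    also have "\<dots> = cdot (g i) (A *v g j)"
      by (simp add: cdot_cadj_right G flip: matrix_vector_mul_assoc)
    finally show ?thesis by (simp add: g mat_def)
  qed
  then have GAG: "cadj G ** A ** G = mat 1"
    by (simp add: vec_eq_iff)
  define H :: "complex^'n^'n" where "H = cadj G ** A"
  have HG: "H ** G = mat 1" using GAG by (simp add: H_def)
  then have GH: "G ** H = mat 1" using matrix_left_right_inverse by blast
  have restore: "cadj H ** (cadj G ** M ** G) ** H = M" for M
  proof -
    have "cadj H ** (cadj G ** M ** G) ** H = cadj (G ** H) ** M ** (G ** H)"
      by (simp add: cadj_mul matrix_mul_assoc)
    then show ?thesis by (simp add: GH)
  qed
  have "prodvec (cadj G ** A ** G) (cadj G ** B ** G) (cadj G ** C ** G)"
    using ppt_cong[OF ABC, of G] id by (simp add: GAG)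
  from prodvec_lift[OF HG this] show ?thesis by (simp add: restore)
qed

lemma ppt_hpsd:
  assumes "ppt A B C"
  shows "hpsd A"
proof -
  have "0 \<le> inner (x, 0) (bop A B C (x, 0))" for x
    using assms by (auto simp: ppt_def)
  then show ?thesis
    using assms by (simp add: hpsd_def ppt_def bop_def Re_cdot)
qed

text \<open>Both quadratic forms vanish at \<open>(f, 0)\<close>, so both operators annihilate it;
  the second components give the two claims.\<close>

lemma ppt_kernel:
  assumes "ppt A B C" "A *v f = 0"
  shows "B *v f = 0" "cadj B *v f = 0"
proof -
  have herm: "cadj A = A" "cadj C = C" and pos: "\<And>w. 0 \<le> inner w (bop A B C w)"
    and pos': "\<And>w. 0 \<le> inner w (bop A (cadj B) C w)"
    using assms(1) by (auto simp: ppt_def)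
  have "bop A B C (f, 0) = 0"
    by (rule psd_form_kernel[OF linear_bop bop_self_adjoint[OF herm] pos]) (simp add: bop_def assms(2))
  moreover have "bop A (cadj B) C (f, 0) = 0"
    by (rule psd_form_kernel[OF linear_bop bop_self_adjoint[OF herm] pos']) (simp add: bop_def assms(2))
  ultimately show "B *v f = 0" "cadj B *v f = 0"
    by (simp_all add: bop_def zero_prod_def)
qed

text \<open>If \<open>A\<close> is injective it can be normalised to the identity. If
  \<open>A *v f = 0\<close> but \<open>C *v f\<close> is non-zero, both operators send
  \<open>(0, f)\<close> to \<open>(0, C *v f)\<close>, a product vector. Otherwise all blocks
  annihilate \<open>f\<close>, which is the case left to \<open>sing\<close>.\<close>

lemma prodvec_reduce:
  fixes A B C :: "complex^'n^'n"
  assumes id: "\<And>N C :: complex^'n^'n. ppt (mat 1) N C \<Longrightarrow> prodvec (mat 1) N C"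
    and ABC: "ppt A B C"
    and sing: "\<And>f. f \<noteq> 0 \<Longrightarrow> A *v f = 0 \<Longrightarrow> B *v f = 0 \<Longrightarrow> cadj B *v f = 0 \<Longrightarrow> C *v f = 0 \<Longrightarrow> prodvec A B C"
  shows "prodvec A B C"
proof (cases "\<exists>f. f \<noteq> 0 \<and> A *v f = 0")
  case False
  then show ?thesis using prodvec_posdef[OF id ABC ppt_hpsd[OF ABC]] by blast
next
  case True
  then obtain f where f: "f \<noteq> 0" "A *v f = 0" by blast
  note B = ppt_kernel[OF ABC f(2)]
  show ?thesis
  proof (cases "C *v f = 0")
    case True
    then show ?thesis using sing f B by blast
  next
    case False
    have "bop A B C (0, f) = (0 *s (C *v f), 1 *s (C *v f))"
      "bop A (cadj B) C (0, f) = (cnj 0 *s (C *v f), cnj 1 *s (C *v f))"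
      by (simp_all add: bop_def B)
    with False show ?thesis
      unfolding prodvec_def by (metis prod.inject zero_neq_one)
  qed
qed

text \<open>A common kernel vector \<open>f\<close> of all blocks is divided out, so the problem
  comes from a space of one dimension less.\<close>

lemma prodvec_step:
  fixes A B C :: "complex^'n^'n"
  assumes id: "\<And>N C :: complex^'n^'n. ppt (mat 1) N C \<Longrightarrow> prodvec (mat 1) N C"
    and lower: "\<And>A B C :: complex^'m^'m. ppt A B C \<Longrightarrow> (A, B, C) \<noteq> (0, 0, 0) \<Longrightarrow> prodvec A B C"
    and card: "CARD('n) = CARD('m) + 1"
    and ABC: "ppt A B C" "(A, B, C) \<noteq> (0, 0, 0)"
  shows "prodvec A B C"
proof (rule prodvec_reduce[OF id ABC(1)])
  fix f assume f: "f \<noteq> 0" "A *v f = 0" "B *v f = 0" "cadj B *v f = 0" "C *v f = 0"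
  then obtain j where j: "f $ j \<noteq> 0" by (auto simp: vec_eq_iff)
  have "card (UNIV :: 'm set) = card (UNIV - {j} :: 'n set)"
    using card by simp
  then obtain \<sigma> :: "'m \<Rightarrow> 'n" where \<sigma>: "bij_betw \<sigma> UNIV (UNIV - {j})"
    using finite_same_card_bij[of "UNIV :: 'm set" "UNIV - {j}"] by auto
  define E :: "complex^'m^'n" where "E = (\<chi> i c. if i = \<sigma> c then 1 else 0)"
  \<comment> \<open>\<open>D\<close> projects along \<open>f\<close> onto the coordinates other than
    \<open>j\<close>, and \<open>E\<close> embeds these back; thus \<open>E\<close> after
    \<open>D\<close> changes a vector only by a multiple of \<open>f\<close>.\<close>
  define D :: "complex^'n^'m" where
    "D = (\<chi> c i. (if i = \<sigma> c then 1 else 0) - (if i = j then f $ \<sigma> c / f $ j else 0))"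
  have \<sigma>j: "\<sigma> c \<noteq> j" for c using \<sigma> by (auto simp: bij_betw_def)
  have inj: "\<sigma> c = \<sigma> d \<longleftrightarrow> c = d" for c d using \<sigma> by (auto simp: bij_betw_def inj_eq)
  have DE: "D ** E = mat 1"
    by (simp add: vec_eq_iff matrix_matrix_mult_def D_def E_def mat_def left_diff_distrib sum_subtractf
        if_distrib[of "\<lambda>z. z * _"] inj \<sigma>j \<sigma>j[symmetric] cong: if_cong)
  have ED: "E *v (D *v x) = x - (x $ j / f $ j) *s f" for x
  proof -
    have Dx: "(D *v x) $ c = x $ \<sigma> c - f $ \<sigma> c / f $ j * x $ j" for c
      by (simp add: matrix_vector_mult_def D_def left_diff_distrib sum_subtractf
        if_distrib[of "\<lambda>z. z * _"] cong: if_cong)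
    have "(E *v (D *v x)) $ i = x $ i - x $ j / f $ j * f $ i" for i
    proof (cases "i = j")
      case True
      then have "(E *v (D *v x)) $ i = 0"
        using \<sigma>j[symmetric] by (simp add: matrix_vector_mult_def E_def)
      then show ?thesis using True j by simp
    next
      case False
      then obtain c where c: "i = \<sigma> c" using \<sigma> by (auto simp: bij_betw_def)
      have "(E *v y) $ \<sigma> c = y $ c" for y
        by (simp add: matrix_vector_mult_def E_def inj if_distrib[of "\<lambda>z. z * _"] cong: if_cong)
      then show ?thesis by (simp add: Dx c)
    qed
    then show ?thesis by (simp add: vec_eq_iff)
  qed
  have restore: "cadj D ** (cadj E ** M ** E) ** D = M" if "M *v f = 0" "cadj M *v f = 0" for M
  proof -
    have 1: "M' *v (E *v (D *v x)) = M' *v x" if "M' *v f = 0" for M' :: "complex^'n^'n" and x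
      using that by (simp add: ED matrix_vector_mult_diff_distrib vec.scale)
    have "cdot y ((cadj D ** (cadj E ** M ** E) ** D) *v x) = cdot y (M *v x)" for x y
    proof -
      have "cdot y ((cadj D ** (cadj E ** M ** E) ** D) *v x) = cdot (E *v (D *v y)) (M *v x)"
        by (simp add: cdot_cadj_right 1[OF that(1)] flip: matrix_vector_mul_assoc)
      also have "\<dots> = cdot (cadj M *v (E *v (D *v y))) x"
        by (simp add: cdot_cadj_left)
      finally show ?thesis by (simp add: 1[OF that(2)] cdot_cadj_left)
    qed
    then have "cdot (axis i 1) ((cadj D ** (cadj E ** M ** E) ** D) *v axis k 1)
        = cdot (axis i 1) (M *v axis k 1)" for i k
      by blast
    then show ?thesis
      by (simp add: vec_eq_iff cdot_axis_left matrix_axis_component)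
  qed
  have herm: "cadj A = A" "cadj C = C" using ABC(1) by (auto simp: ppt_def)
  have bk: "cadj D ** (cadj E ** A ** E) ** D = A" "cadj D ** (cadj E ** B ** E) ** D = B"
    "cadj D ** (cadj E ** C ** E) ** D = C"
    using restore f herm by simp_all
  have "prodvec (cadj E ** A ** E) (cadj E ** B ** E) (cadj E ** C ** E)"
  proof (rule lower[OF ppt_cong[OF ABC(1)]])
    show "(cadj E ** A ** E, cadj E ** B ** E, cadj E ** C ** E) \<noteq> (0, 0, 0)"
      using ABC(2) bk by auto
  qed
  from prodvec_lift[OF DE this] show "prodvec A B C" by (simp add: bk)
qed

section \<open>Existence of product vectors\<close>

lemma matrix_diff_ldistrib: "M ** (A - B) = M ** A - M ** B" for M :: "complex^'n^'m"
  by (simp add: vec_eq_iff matrix_matrix_mult_def sum_subtractf right_diff_distrib)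

lemma matrix_add_rdistrib: "(A + B) ** M = A ** M + B ** M" for M :: "complex^'n^'m"
  by (simp add: vec_eq_iff matrix_matrix_mult_def sum.distrib distrib_right)

text \<open>With \<open>P = cadj N ** N\<close> and \<open>Q = N ** cadj N\<close>, cyclicity gives
  equal traces for the squares of \<open>P\<close> and \<open>Q\<close>, and for
  \<open>P ** Q\<close> and \<open>Q ** P\<close>.\<close>

lemma trace_normal_defect: "trace ((cadj N ** N + N ** cadj N) ** (cadj N ** N - N ** cadj N)) = 0"
proof -
  have "trace (cadj N ** N ** (cadj N ** N)) = trace (N ** cadj N ** (N ** cadj N))"
    using trace_mul_sym[of "cadj N" "N ** cadj N ** N"] by (simp add: matrix_mul_assoc)
  moreover have "trace (cadj N ** N ** (N ** cadj N)) = trace (N ** cadj N ** (cadj N ** N))"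
    by (rule trace_mul_sym)
  ultimately show ?thesis
    by (simp add: matrix_diff_ldistrib matrix_add_rdistrib trace_add trace_sub)
qed

text \<open>The vector \<open>e\<close> is an eigenvector with a real eigenvalue \<open>m\<close>,
  which is non-negative; self-adjointness then fixes the coefficient of \<open>R *v x\<close>
  through \<open>cdot e x\<close>.\<close>

lemma hpsd_rank_one:
  fixes R :: "complex^'n^'n"
  assumes R: "hpsd R" and "e \<noteq> 0" and range: "\<And>x. \<exists>c. R *v x = c *s e"
  obtains r where "R = dyad r r"
proof -
  obtain c where c: "R *v e = c *s e" using range by blast
  define n where "n = (norm e)\<^sup>2"
  have n: "cdot e e = of_real n" "n > 0" using \<open>e \<noteq> 0\<close> by (simp_all add: cdot_self n_def)
  have "c * of_real n = of_real (Re (cdot e (R *v e)))"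
    using hpsd_cdot_real[OF R, of e] by (simp add: c cdot_simps n)
  then have c': "c = of_real (Re (cdot e (R *v e)) / n)"
    using n(2) by (simp add: field_simps)
  define m where "m = Re (cdot e (R *v e)) / n"
  have m: "c = of_real m" "m \<ge> 0" using c' R n(2) by (auto simp: m_def hpsd_def)
  define r where "r = of_real (sqrt (m / n)) *s e"
  have "R *v x = dyad r r *v x" for x
  proof -
    obtain d where d: "R *v x = d *s e" using range by blast
    have "d * of_real n = cdot e (R *v x)" by (simp add: d cdot_simps n)
    also have "\<dots> = of_real m * cdot e x"
      using hpsd_cdot[OF R, of e x] by (simp add: c cdot_simps m)
    finally have "d = of_real m * cdot e x / of_real n" using n(2) by (simp add: field_simps)
    moreover have "of_real (sqrt (m / n)) * (of_real (sqrt (m / n)) :: complex) = of_real (m / n)"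
      using m(2) n(2) by (simp flip: of_real_mult)
    then have "of_real (sqrt (m / n)) * (of_real (sqrt (m / n)) * z) = of_real (m / n) * z" for z :: complex
      by (metis mult.assoc)
    ultimately show ?thesis
      by (simp add: d r_def dyad_mult_vec cdot_simps vector_smult_assoc mult_ac)
  qed
  then have "R = dyad r r" by (rule matrix_eqI)
  then show ?thesis by (rule that)
qed

lemma surj_of_inj:
  fixes R :: "complex^'n^'n"
  assumes "\<And>x. R *v x = 0 \<Longrightarrow> x = 0"
  obtains u where "R *v u = y"
proof -
  obtain B where "B ** R = mat 1"
    using assms matrix_left_invertible_ker[of R] by blast
  then have "R ** B = mat 1" using matrix_left_right_inverse by blast
  then have "R *v (B *v y) = y" by (simp add: matrix_vector_mul_assoc)
  then show ?thesis by (rule that)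
qed

text \<open>The hypotheses say that the block matrix with rows \<open>(N, q)\<close> and \<open>(r*, t)\<close> is normal.\<close>

lemma normal_dilation_eigenvector:
  fixes N :: "complex^'n^'n"
  assumes comm: "cadj N ** N + dyad r r = N ** cadj N + dyad q q"
    and mixed: "cadj N *v q + t *s r = N *v r + cnj t *s q"
    and norms: "cdot r r = cdot q q" and "q \<noteq> 0"
  obtains f l x where "f \<noteq> 0" "N *v f + x *s q = l *s f" "cadj N *v f + x *s r = cnj l *s f"
proof -
  \<comment> \<open>The index \<open>None\<close> carries the extra dimension.\<close>
  define lift :: "complex^'n \<Rightarrow> complex \<Rightarrow> complex^('n option)" where
    "lift f x = (\<chi> i. case i of None \<Rightarrow> x | Some a \<Rightarrow> f $ a)" for f x
  define M :: "complex^('n option)^('n option)" where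
    "M = (\<chi> i. case i of None \<Rightarrow> (\<chi> j. case j of None \<Rightarrow> t | Some b \<Rightarrow> cnj (r $ b))
       | Some a \<Rightarrow> (\<chi> j. case j of None \<Rightarrow> q $ a | Some b \<Rightarrow> N $ a $ b))"
  have sum_opt: "(\<Sum>j\<in>UNIV. h j) = h None + (\<Sum>b\<in>UNIV. h (Some b))" for h :: "'n option \<Rightarrow> complex"
    by (simp add: UNIV_option_conv sum.reindex)
  have M: "M *v lift f x = lift (N *v f + x *s q) (cdot r f + t * x)" for f x
    by (simp add: vec_eq_iff matrix_vector_mult_def sum_opt lift_def M_def cdot_def split: option.split)
  have Ms: "cadj M *v lift f x = lift (cadj N *v f + x *s r) (cdot q f + cnj t * x)" for f x
    by (simp add: vec_eq_iff matrix_vector_mult_def sum_opt lift_def M_def cdot_def cadj_def split: option.split)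
  have lift: "\<exists>f x. v = lift f x" for v
    by (rule exI[of _ "\<chi> a. v $ Some a"], rule exI[of _ "v $ None"])
      (simp add: vec_eq_iff lift_def split: option.split)
  have eq: "lift f x = lift g y \<longleftrightarrow> f = g \<and> x = y" for f g x y
    by (auto simp: lift_def vec_eq_iff split: option.splits)
  have scale: "l *s lift f x = lift (l *s f) (l * x)" for l f x
    by (simp add: vec_eq_iff lift_def split: option.split)
  have normal: "cadj M ** M = M ** cadj M"
  proof (rule matrix_eqI)
    fix v
    obtain f x where v: "v = lift f x" using lift by blast
    have a: "cadj N *v (N *v f) + cdot r f *s r = N *v (cadj N *v f) + cdot q f *s q"
      using arg_cong[OF comm, of "\<lambda>X. X *v f"]
      by (simp add: matrix_vector_mult_add_rdistrib dyad_mult_vec matrix_vector_mul_assoc)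
    have b: "x *s (cadj N *v q) + (t * x) *s r = x *s (N *v r) + (cnj t * x) *s q"
      using arg_cong[OF mixed, of "\<lambda>y. x *s y"]
      by (simp add: vec.scale_right_distrib vector_smult_assoc mult.commute)
    have "cadj N *v (N *v f + x *s q) + (cdot r f + t * x) *s r
        = (cadj N *v (N *v f) + cdot r f *s r) + (x *s (cadj N *v q) + (t * x) *s r)"
      by (simp add: matrix_vector_right_distrib vec.scale vec.scale_left_distrib add_ac)
    also have "\<dots> = N *v (cadj N *v f + x *s r) + (cdot q f + cnj t * x) *s q"
      unfolding a b by (simp add: matrix_vector_right_distrib vec.scale vec.scale_left_distrib add_ac)
    finally have 1: "cadj N *v (N *v f + x *s q) + (cdot r f + t * x) *s r
        = N *v (cadj N *v f + x *s r) + (cdot q f + cnj t * x) *s q" .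
    have "cdot (cadj N *v q + t *s r) f = cdot (N *v r + cnj t *s q) f"
      by (simp add: mixed)
    then have 2: "cdot q (N *v f + x *s q) + cnj t * (cdot r f + t * x)
        = cdot r (cadj N *v f + x *s r) + t * (cdot q f + cnj t * x)"
      by (simp add: cdot_simps norms cdot_cadj_left cdot_cadj_right algebra_simps)
    show "(cadj M ** M) *v v = (M ** cadj M) *v v"
      by (simp only: v M Ms 1 2 flip: matrix_vector_mul_assoc)
  qed
  obtain v l where v: "v \<noteq> 0" "M *v v = l *s v" by (rule eigenvector_exists)
  note v' = normal_eigenvector[OF normal v(2)]
  obtain f x where fx: "v = lift f x" using lift by blast
  have N: "N *v f + x *s q = l *s f" "cadj N *v f + x *s r = cnj l *s f"
    using v(2) v' by (simp_all add: fx M Ms scale eq)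
  have "f \<noteq> 0"
  proof
    assume "f = 0"
    then have "x *s q = 0" using N(1) by simp
    then have "x = 0" using \<open>q \<noteq> 0\<close> by simp
    then have "v = 0" using \<open>f = 0\<close> by (simp add: fx lift_def vec_eq_iff split: option.split)
    with v(1) show False by simp
  qed
  then show ?thesis using N by (rule that)
qed

text \<open>Supplies the phase \<open>c\<close> and the corner entry \<open>t\<close> of the dilation, with \<open>x = N r\<close> and \<open>y = N* s\<close>:
  the Gram matrices of \<open>(r, s, x)\<close> and \<open>(s, r, y)\<close> are conjugate, so the components of \<open>x\<close> and \<open>y\<close>
  orthogonal to \<open>r, s\<close> have the same length, and these lie on a line in dimension at most three.\<close>

lemma phase_matching:
  fixes r s x y :: "complex^'n"
  assumes par: "\<And>v w. v \<noteq> 0 \<Longrightarrow> cdot r v = 0 \<Longrightarrow> cdot s v = 0 \<Longrightarrow> cdot r w = 0 \<Longrightarrow> cdot s w = 0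
      \<Longrightarrow> \<exists>c. w = c *s v"
    and indep: "cdot r r * cdot s s \<noteq> cdot r s * cdot s r"
    and norms: "cdot r r = cdot s s" "cdot x x = cdot y y"
    and gram: "cdot s y = cnj (cdot r x)" "cdot r y = cnj (cdot s x)"
  obtains c t where "cmod c = 1" "c *s y - x = (c * cnj t) *s s - t *s r"
proof -
  define l h m n where "l = cdot r r" and "h = cdot r s" and "m = cdot r x" and "n = cdot s x"
  have ys: "cdot y s = cnj (cdot s y)" "cdot y r = cnj (cdot r y)"
    by (simp_all only: cnj_cdot)
  have h': "cdot s r = cnj h" and l': "cnj l = l" and mn: "cdot x r = cnj m" "cdot x s = cnj n"
      "cdot y s = m" "cdot y r = n"
    unfolding h_def l_def m_def n_def
    by (simp_all only: cnj_cdot ys gram complex_cnj_cnj)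
  define \<Delta> where "\<Delta> = l * l - h * cnj h"
  have "\<Delta> \<noteq> 0" using indep by (simp add: \<Delta>_def l_def h_def norms(1) cnj_cdot)
  \<comment> \<open>Cramer's rule for the Gram matrix: \<open>a *s r + b *s s\<close> is the
    orthogonal projection of \<open>x\<close> onto the span of \<open>r\<close> and
    \<open>s\<close>. The projection of \<open>y\<close> has the conjugate coefficients with
    \<open>r\<close> and \<open>s\<close> exchanged.\<close>
  define a b where "a = (l * m - h * n) / \<Delta>" and "b = (l * n - cnj h * m) / \<Delta>"
  have "l * (l * m - h * n) + h * (l * n - cnj h * m) = \<Delta> * m"
    "cnj h * (l * m - h * n) + l * (l * n - cnj h * m) = \<Delta> * n"
    by (simp_all add: \<Delta>_def algebra_simps)
  then have ab: "l * a + h * b = m" "cnj h * a + l * b = n"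
    using \<open>\<Delta> \<noteq> 0\<close> by (simp_all add: a_def b_def add_divide_distrib[symmetric])
  have abc: "l * cnj a + cnj h * cnj b = cnj m" "h * cnj a + l * cnj b = cnj n"
    using arg_cong[OF ab(1), of cnj] arg_cong[OF ab(2), of cnj] l' by simp_all
  define x' y' where "x' = x - a *s r - b *s s" and "y' = y - cnj b *s r - cnj a *s s"
  have l2: "cdot s s = l" "cdot r r = l" "cdot r s = h" "cdot r x = m" "cdot s x = n"
    using norms by (simp_all add: l_def h_def m_def n_def)
  have perp: "cdot r x' = 0" "cdot s x' = 0" "cdot r y' = 0" "cdot s y' = 0"
    using ab abc by (simp_all add: x'_def y'_def cdot_simps gram l2 h') (simp_all add: algebra_simps)
  have "cdot x' x' = cdot x x' - cnj a * cdot r x' - cnj b * cdot s x'"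
    "cdot y' y' = cdot y y' - b * cdot r y' - a * cdot s y'"
    by (subst (1) x'_def y'_def, simp add: cdot_simps)+
  then have "cdot x' x' = cdot x x'" "cdot y' y' = cdot y y'"
    using perp by simp_all
  then have "cdot x' x' = cdot x x - a * cnj m - b * cnj n"
    "cdot y' y' = cdot y y - cnj b * n - cnj a * m"
    by (simp_all add: x'_def y'_def cdot_simps mn)
  moreover from this(2) have "cnj (cdot y' y') = cdot y y - b * cnj n - a * cnj m"
    using cnj_cdot[of y y] by simp
  ultimately have "cdot x' x' = cnj (cdot y' y')"
    using norms(2) by simp
  then have nrm: "norm x' = norm y'"
    by (simp add: cdot_self flip: of_real_power)
  have "\<exists>c. cmod c = 1 \<and> x' = c *s y'"
  proof (cases "y' = 0")
    case True
    then show ?thesis using nrm by (intro exI[of _ 1]) simp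
  next
    case False
    then obtain c where c: "x' = c *s y'" using par perp by blast
    have "cdot x' x' = of_real ((cmod c)\<^sup>2) * cdot y' y'"
      using complex_norm_square[of c] by (simp add: c cdot_simps mult_ac)
    then have "(cmod c)\<^sup>2 = 1"
      using nrm False by (simp add: cdot_self flip: of_real_power of_real_mult)
    then have "cmod c = 1" using norm_ge_zero[of c] by (auto simp: power2_eq_1_iff simp del: norm_ge_zero)
    then show ?thesis using c by blast
  qed
  then obtain c where c: "cmod c = 1" "x' = c *s y'" by blast
  have cc: "c * cnj c = 1" using complex_norm_square[of c] c(1) by simp
  \<comment> \<open>Read off from \<open>x' = c *s y'\<close> as minus the coefficient of
    \<open>r\<close>; the coefficient of \<open>s\<close> is then \<open>c * cnj t\<close>, since
    \<open>c\<close> has modulus one.\<close>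
  define t where "t = a - c * cnj b"
  have ct: "c * cnj t = c * cnj a - b"
    using cc by (simp add: t_def algebra_simps flip: mult.assoc)
  have "x $ i - a * r $ i - b * s $ i = c * (y $ i - cnj b * r $ i - cnj a * s $ i)" for i
    using arg_cong[OF c(2), of "\<lambda>v. v $ i"] by (simp add: x'_def y'_def algebra_simps)
  then have "c * y $ i - x $ i = c * cnj t * s $ i - t * r $ i" for i
    unfolding ct unfolding t_def by (simp add: algebra_simps)
  then have "c *s y - x = (c * cnj t) *s s - t *s r" by (simp add: vec_eq_iff)
  with c(1) show ?thesis by (rule that)
qed

text \<open>In the case of equality the component \<open>w\<close> of \<open>s\<close> orthogonal to
  \<open>r\<close> has norm 0.\<close>

lemma cauchy_schwarz_strict:
  assumes "r \<noteq> 0" "\<And>c. s \<noteq> c *s r"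
  shows "cdot r r * cdot s s \<noteq> cdot r s * cdot s r"
proof
  assume eq: "cdot r r * cdot s s = cdot r s * cdot s r"
  define w where "w = s - (cdot r s / cdot r r) *s r"
  have rr: "cdot r r \<noteq> 0" using assms(1) by simp
  have "cdot r w = 0" using rr by (simp add: w_def cdot_simps)
  moreover have "cdot w w = cdot s w - cnj (cdot r s / cdot r r) * cdot r w"
    by (subst (1) w_def) (simp only: cdot_simps)
  ultimately have "cdot w w = cdot s w" by simp
  also have "\<dots> = 0" using rr eq by (simp add: w_def cdot_simps field_simps)
  finally show False using assms(2) by (simp add: w_def)
qed

section \<open>Normalised blocks: Schur complements and range conditions\<close>

locale unit_ppt =
  fixes N C :: "complex^'n^'n"
  assumes ppt: "ppt (mat 1) N C"
begin

text \<open>\<open>R\<close> and \<open>S\<close> are the Schur complements of the identity block in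
  the operator and in its partial transpose.\<close>

definition "R = C - cadj N ** N"
definition "S = C - N ** cadj N"

lemma R_vec: "R *v x = C *v x - cadj N *v (N *v x)"
  and S_vec: "S *v x = C *v x - N *v (cadj N *v x)"
  by (simp_all add: R_def S_def matrix_vector_mult_diff_rdistrib matrix_vector_mul_assoc)

text \<open>On \<open>(- (N *v x), x)\<close> the block operator has first component 0, so its form
  reduces to that of \<open>R\<close> at \<open>x\<close>.\<close>

lemma hpsd_R: "hpsd R"
proof -
  have "0 \<le> inner (- (N *v x), x) (bop (mat 1) N C (- (N *v x), x))" for x
    using ppt by (auto simp: ppt_def)
  then have "0 \<le> Re (cdot x (R *v x))" for x
    by (simp add: bop_def matrix_vector_neg Re_cdot R_vec)
  moreover have "cadj R = R"
    using ppt by (simp add: ppt_def R_def cadj_diff cadj_mul)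
  ultimately show ?thesis by (simp add: hpsd_def)
qed

lemma hpsd_S: "hpsd S"
proof -
  have "0 \<le> inner (- (cadj N *v x), x) (bop (mat 1) (cadj N) C (- (cadj N *v x), x))" for x
    using ppt by (auto simp: ppt_def)
  then have "0 \<le> Re (cdot x (S *v x))" for x
    by (simp add: bop_def matrix_vector_neg Re_cdot S_vec)
  moreover have "cadj S = S"
    using ppt by (simp add: ppt_def S_def cadj_diff cadj_mul)
  ultimately show ?thesis by (simp add: hpsd_def)
qed

lemma commutator: "cadj N ** N - N ** cadj N = S - R"
  by (simp add: R_def S_def)

lemma trace_eq: "trace R = trace S"
proof -
  have "trace (S - R) = 0"
    using trace_mul_sym[of "cadj N" N] by (simp add: trace_sub flip: commutator)
  then show ?thesis by (simp add: trace_sub)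
qed

text \<open>The case \<open>e = (0, 1)\<close>, in which \<open>f\<close> itself must lie in both
  ranges.\<close>

lemma prodvec_infinite:
  assumes "f \<noteq> 0" "R *v u = f" "S *v u' = f"
  shows "prodvec (mat 1) N C"
proof -
  have "bop (mat 1) N C (- (N *v u), u) = (0 *s f, 1 *s f)"
    using assms(2) by (simp add: bop_def matrix_vector_neg R_vec)
  moreover have "bop (mat 1) (cadj N) C (- (cadj N *v u'), u') = (cnj 0 *s f, cnj 1 *s f)"
    using assms(3) by (simp add: bop_def matrix_vector_neg S_vec)
  ultimately show ?thesis
    unfolding prodvec_def using assms(1) by (metis prod.inject zero_neq_one)
qed

text \<open>The case \<open>e = (1, z)\<close>; the preimage \<open>(f + N *v u, - u)\<close> solves
  the first row for any \<open>u\<close>, and the second row becomes the condition on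
  \<open>R *v u\<close>.\<close>

lemma prodvec_finite:
  assumes "f \<noteq> 0" "R *v u = cadj N *v f - z *s f" "S *v u' = N *v f - cnj z *s f"
  shows "prodvec (mat 1) N C"
proof -
  have "C *v u = cadj N *v (N *v u) + (cadj N *v f - z *s f)"
    using assms(2) by (simp add: R_vec algebra_simps)
  then have "bop (mat 1) N C (f + N *v u, - u) = (1 *s f, z *s f)"
    by (simp add: bop_def matrix_vector_neg matrix_vector_right_distrib)
  moreover have "C *v u' = N *v (cadj N *v u') + (N *v f - cnj z *s f)"
    using assms(3) by (simp add: S_vec algebra_simps)
  then have "bop (mat 1) (cadj N) C (f + cadj N *v u', - u') = (cnj 1 *s f, cnj z *s f)"
    by (simp add: bop_def matrix_vector_neg matrix_vector_right_distrib)
  ultimately show ?thesis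
    unfolding prodvec_def using assms(1) by (metis prod.inject zero_neq_one)
qed

text \<open>\<open>R\<close> is onto, so only the condition on \<open>S\<close> remains; an
  eigenvector of \<open>N\<close> meets it with \<open>u' = 0\<close>.\<close>

lemma prodvec_R_inj:
  assumes "\<And>x. R *v x = 0 \<Longrightarrow> x = 0"
  shows "prodvec (mat 1) N C"
proof -
  obtain f l where f: "f \<noteq> 0" "N *v f = l *s f" by (rule eigenvector_exists)
  obtain u where "R *v u = cadj N *v f - cnj l *s f" using assms by (rule surj_of_inj)
  then show ?thesis by (rule prodvec_finite[OF f(1), where u'=0]) (simp add: f)
qed

lemma prodvec_S_inj:
  assumes "\<And>x. S *v x = 0 \<Longrightarrow> x = 0"
  shows "prodvec (mat 1) N C"
proof -
  obtain f l where f: "f \<noteq> 0" "cadj N *v f = l *s f" by (rule eigenvector_exists)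
  obtain u where "S *v u = N *v f - cnj l *s f" using assms by (rule surj_of_inj)
  then show ?thesis by (rule prodvec_finite[OF f(1), where u=0, rotated]) (simp add: f)
qed

text \<open>Both Schur complements vanish, so \<open>N\<close> is normal and an eigenvector of
  \<open>N\<close> is also one of \<open>cadj N\<close>.\<close>

lemma prodvec_trace_0:
  assumes "trace R = 0"
  shows "prodvec (mat 1) N C"
proof -
  have 0: "R = 0" "S = 0"
    using hpsd_trace_0[OF hpsd_R] hpsd_trace_0[OF hpsd_S] assms trace_eq by simp_all
  then have normal: "cadj N ** N = N ** cadj N" using commutator by simp
  obtain f l where f: "f \<noteq> 0" "N *v f = l *s f" by (rule eigenvector_exists)
  have "cadj N *v f = cnj l *s f" by (rule normal_eigenvector[OF normal f(2)])
  then show ?thesis by (intro prodvec_finite[OF f(1), where u=0 and u'=0 and z="cnj l"]) (simp_all add: f)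
qed

text \<open>Parallel \<open>r\<close> and \<open>s\<close> span the same range, which gives a
  product vector at infinity. For independent ones \<open>par\<close> confines their common
  orthogonal complement to a line, \<open>phase_matching\<close> applies, and an eigenvector of the
  normal dilation supplies \<open>f\<close>.\<close>

lemma prodvec_rank_one:
  assumes R: "R = dyad r r" and S: "S = dyad s s"
    and par: "\<And>v w. r \<noteq> 0 \<Longrightarrow> (\<And>c. s \<noteq> c *s r) \<Longrightarrow> v \<noteq> 0 \<Longrightarrow> cdot r v = 0 \<Longrightarrow> cdot s v = 0
      \<Longrightarrow> cdot r w = 0 \<Longrightarrow> cdot s w = 0 \<Longrightarrow> \<exists>c. w = c *s v"
  shows "prodvec (mat 1) N C"
proof (cases "r = 0")
  case True
  then show ?thesis by (intro prodvec_trace_0) (simp add: R trace_dyad cdot_simps)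
next
  case False
  have norms: "cdot r r = cdot s s" using trace_eq by (simp add: R S trace_dyad)
  have "s \<noteq> 0" using False norms by (metis cdot_self_eq_0)
  show ?thesis
  proof (cases "\<exists>c. s = c *s r")
    case True
    then obtain c where c: "s = c *s r" by blast
    with \<open>s \<noteq> 0\<close> have "c \<noteq> 0" by auto
    have "R *v ((1 / cdot r r) *s r) = r" "S *v ((1 / (c * cdot s s)) *s s) = r"
      using False \<open>s \<noteq> 0\<close> \<open>c \<noteq> 0\<close> by (simp_all add: R S dyad_mult_vec cdot_simps)
        (simp add: c vector_smult_assoc)
    then show ?thesis by (rule prodvec_infinite[OF False])
  next
    case indep: False
    have e: "cdot x (cadj N *v (N *v x)) = cdot (N *v x) (N *v x)"
      "cdot x (N *v (cadj N *v x)) = cdot (cadj N *v x) (cadj N *v x)" for x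
      by (rule cdot_cadj_right, rule cdot_cadj_left[symmetric])
    have comm: "cdot (N *v x) (N *v x) - cdot (cadj N *v x) (cadj N *v x)
        = cdot x s * cdot s x - cdot x r * cdot r x" for x
    proof -
      have "cdot x ((cadj N ** N - N ** cadj N) *v x) = cdot x ((S - R) *v x)"
        by (simp add: commutator)
      then show ?thesis
        by (simp add: matrix_vector_mult_diff_rdistrib R S dyad_mult_vec cdot_simps e
            mult.commute flip: matrix_vector_mul_assoc)
    qed
    have "trace (N ** (cadj N ** N - N ** cadj N)) = 0"
      using trace_mul_sym[of N "cadj N ** N"] trace_mul_sym[of "N ** N" "cadj N"]
        trace_mul_sym[of N "N ** cadj N"]
      by (simp add: matrix_diff_ldistrib trace_sub matrix_mul_assoc)
    then have m: "cdot r (N *v r) = cdot s (N *v s)"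
      by (simp add: commutator R S matrix_diff_ldistrib trace_sub mult_dyad trace_dyad)
    \<comment> \<open>This gives the sum relation; together with \<open>comm\<close> at
      \<open>r\<close> and at \<open>s\<close>, whose right-hand sides are opposite, it yields equal
      norms of \<open>N *v r\<close> and \<open>cadj N *v s\<close>.\<close>
    have "trace ((cadj N ** N + N ** cadj N) ** (S - R)) = 0"
      using trace_normal_defect[of N] by (simp add: commutator)
    then have sum: "cdot (N *v s) (N *v s) + cdot (cadj N *v s) (cadj N *v s)
        = cdot (N *v r) (N *v r) + cdot (cadj N *v r) (cadj N *v r)"
      by (simp add: R S matrix_diff_ldistrib trace_sub mult_dyad trace_dyad matrix_vector_mult_add_rdistrib
          cdot_simps e flip: matrix_vector_mul_assoc)
    have two: "2 * c = 2 * b" if "a + b = c + d" "c - d = k - l" "a - b = l - k" for a b c d k l :: complex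
    proof -
      have "2 * c = (c + d) + (c - d)" by simp
      also have "\<dots> = (a + b) - (a - b)" unfolding that by simp
      finally show ?thesis by simp
    qed
    have "2 * cdot (N *v r) (N *v r) = 2 * cdot (cadj N *v s) (cadj N *v s)"
      by (rule two[OF sum comm[of r]]) (simp add: comm norms mult.commute)
    then have nrm: "cdot (N *v r) (N *v r) = cdot (cadj N *v s) (cadj N *v s)" by simp
    obtain c t where c: "cmod c = 1"
      and ct: "c *s (cadj N *v s) - N *v r = (c * cnj t) *s s - t *s r"
    proof (rule phase_matching[of r s "N *v r" "cadj N *v s"])
      show "cdot r r * cdot s s \<noteq> cdot r s * cdot s r"
        using cauchy_schwarz_strict False indep by blast
      show "cdot s (cadj N *v s) = cnj (cdot r (N *v r))"
        by (simp add: m cdot_cadj_right cnj_cdot)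
      show "cdot r (cadj N *v s) = cnj (cdot s (N *v r))"
        by (simp add: cdot_cadj_right cnj_cdot)
    qed (use par False indep norms nrm in auto)
    \<comment> \<open>The phase is absorbed into \<open>s\<close>, which leaves
      \<open>dyad s s\<close> unchanged.\<close>
    define q where "q = c *s s"
    have cc: "c * cnj c = 1" using complex_norm_square[of c] c by simp
    have dq: "dyad q q = dyad s s"
      using cc by (simp add: q_def dyad_def vec_eq_iff mult_ac)
    have "cadj N ** N + dyad r r = N ** cadj N + dyad q q"
      using commutator by (simp add: R S dq algebra_simps)
    moreover have "cadj N *v q + t *s r = N *v r + cnj t *s q"
      using ct by (simp add: q_def vec.scale vector_smult_assoc mult.commute algebra_simps)
    moreover have "cdot r r = cdot q q"
      using cc by (simp add: q_def cdot_simps norms mult.assoc[symmetric] mult.commute)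
    moreover have "q \<noteq> 0" using \<open>s \<noteq> 0\<close> c by (auto simp: q_def)
    ultimately obtain f l x where f: "f \<noteq> 0" "N *v f + x *s q = l *s f" "cadj N *v f + x *s r = cnj l *s f"
      by (rule normal_dilation_eigenvector)
    have "R *v ((- x / cdot r r) *s r) = cadj N *v f - cnj l *s f"
      using False f(3)[symmetric] by (simp add: R dyad_mult_vec cdot_simps)
    moreover have "S *v ((- x * c / cdot s s) *s s) = N *v f - cnj (cnj l) *s f"
      using \<open>s \<noteq> 0\<close> f(2)[symmetric] by (simp add: S dyad_mult_vec cdot_simps q_def vector_smult_assoc)
    ultimately show ?thesis by (rule prodvec_finite[OF f(1)])
  qed
qed

end

section \<open>Dimension at most three\<close>

text \<open>Near infinity \<open>g\<close> looks like a multiple of \<open>z |z|^2\<close>, so on a large circle \<open>- g / E 0\<close> points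
  outwards.\<close>

lemma odd_degree_zero:
  fixes g E :: "complex \<Rightarrow> complex"
  assumes cont: "continuous_on UNIV g" "continuous_on UNIV E" and "E 0 \<noteq> 0"
    and eq: "\<And>z. z \<noteq> 0 \<Longrightarrow> g z = - (z * (z * cnj z)) * E (1 / z)"
  obtains z where "g z = 0"
proof (rule ccontr)
  assume "\<not> thesis"
  then have nz: "g z \<noteq> 0" for z using that by blast
  have "isCont E 0" using cont(2) by (simp add: continuous_on_eq_continuous_at)
  then obtain d where d: "d > 0" "\<And>w. dist w 0 < d \<Longrightarrow> dist (E w) (E 0) < cmod (E 0)"
    unfolding continuous_at_eps_delta using \<open>E 0 \<noteq> 0\<close> by (metis zero_less_norm_iff)
  \<comment> \<open>On the circle of radius \<rho> the point \<open>1 / z\<close> has modulus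
    \<open>d / 2\<close>, where \<open>E\<close> is still close to \<open>E 0\<close>.\<close>
  define \<rho> where "\<rho> = 2 / d"
  have \<rho>: "\<rho> > 0" using d(1) by (simp add: \<rho>_def)
  define h where "h z = g z / E 0" for z
  have hnz: "h z \<noteq> 0" for z using nz \<open>E 0 \<noteq> 0\<close> by (simp add: h_def)
  \<comment> \<open>\<open>F\<close> normalises \<open>h\<close> to the sphere of radius \<rho>. At
    a Brouwer fixed point \<open>h z\<close> is a positive multiple of \<open>z\<close>, but there
    it is also \<open>- z\<close> times a number with positive real part.\<close>
  define F where "F z = of_real \<rho> * h z / of_real (cmod (h z))" for z
  have norm_F: "cmod (F z) = \<rho>" for z
    using hnz[of z] \<rho> by (simp add: F_def norm_mult norm_divide)
  have "continuous_on (cball 0 \<rho>) F"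
    unfolding F_def h_def using nz \<open>E 0 \<noteq> 0\<close>
    by (intro continuous_intros continuous_on_subset[OF cont(1)]) auto
  moreover have "F \<in> cball 0 \<rho> \<rightarrow> cball 0 \<rho>"
    using norm_F by auto
  ultimately obtain z where z: "F z = z"
    by (rule brouwer_ball[OF \<rho>])
  have zr: "cmod z = \<rho>" using norm_F[of z] z by simp
  then have "z \<noteq> 0" using \<rho> by auto
  define e where "e = E (1 / z) / E 0"
  have "dist (E (1 / z)) (E 0) < cmod (E 0)"
    using zr d(1) by (intro d(2)) (simp add: \<rho>_def norm_divide)
  then have "cmod (E (1 / z) - E 0) / cmod (E 0) < 1"
    using \<open>E 0 \<noteq> 0\<close> by (simp add: dist_norm)
  then have "cmod (e - 1) < 1"
    using \<open>E 0 \<noteq> 0\<close> by (simp add: e_def diff_divide_distrib flip: norm_divide)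
  then have "Re e > 0"
    using abs_Re_le_cmod[of "e - 1"] by simp
  have "z * cnj z = of_real (\<rho>\<^sup>2)" using complex_norm_square[of z] zr by simp
  then have h: "h z = - (z * of_real (\<rho>\<^sup>2)) * e"
    unfolding h_def eq[OF \<open>z \<noteq> 0\<close>] by (simp add: e_def)
  have "of_real \<rho> * h z = z * of_real (cmod (h z))"
    using z hnz[of z] by (simp add: F_def field_simps)
  then have "z * (- of_real (\<rho> * \<rho>\<^sup>2) * e) = z * of_real (cmod (h z))"
    by (subst (asm) (1) h) (simp add: algebra_simps)
  then have "- of_real (\<rho> * \<rho>\<^sup>2) * e = of_real (cmod (h z))"
    using \<open>z \<noteq> 0\<close> by (metis mult_left_cancel)
  from arg_cong[OF this, of Re] have "\<rho> * \<rho>\<^sup>2 * Re e = - cmod (h z)"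
    by simp
  moreover have "\<rho> * \<rho>\<^sup>2 * Re e > 0"
    using \<rho> \<open>Re e > 0\<close> by simp
  ultimately show False using norm_ge_zero[of "h z"] by linarith
qed

section \<open>Orthogonality and ranges in dimension three\<close>

definition conj_rows :: "complex^3 \<Rightarrow> complex^3 \<Rightarrow> complex^3 \<Rightarrow> complex^3^3" where
  "conj_rows a b c = cadj (\<chi> i j. if j = 1 then a $ i else if j = 2 then b $ i else c $ i)"

lemma conj_rows_mult_vec: "conj_rows a b c *v f = 0 \<longleftrightarrow> cdot a f = 0 \<and> cdot b f = 0 \<and> cdot c f = 0"
  by (simp add: conj_rows_def cadj_def vec_eq_iff forall_3 matrix_vector_mult_def sum_3 cdot_def)

lemma orthogonal_vector_of_det:
  assumes "det (conj_rows a b c) = 0"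
  obtains f where "f \<noteq> 0" "cdot a f = 0" "cdot b f = 0" "cdot c f = 0"
  using singular_kernel[OF assms] conj_rows_mult_vec by metis

lemma orthogonal_vector:
  fixes a b :: "complex^3"
  obtains f where "f \<noteq> 0" "cdot a f = 0" "cdot b f = 0"
proof -
  have "det (conj_rows a b b) = 0"
    by (simp add: conj_rows_def cadj_def det_3)
  then show ?thesis using orthogonal_vector_of_det that by metis
qed

lemma orthogonal_complement_line:
  fixes r s :: "complex^3"
  assumes "r \<noteq> 0" "\<And>c. s \<noteq> c *s r"
  obtains w where "w \<noteq> 0" "\<And>v. cdot r v = 0 \<Longrightarrow> cdot s v = 0 \<Longrightarrow> \<exists>c. v = c *s w"
proof -
  \<comment> \<open>The conjugate of the cross product of \<open>r\<close> and
    \<open>s\<close>.\<close>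
  define w :: "complex^3" where "w = vector [cnj (r $ 2 * s $ 3 - r $ 3 * s $ 2),
    cnj (r $ 3 * s $ 1 - r $ 1 * s $ 3), cnj (r $ 1 * s $ 2 - r $ 2 * s $ 1)]"
  have "w \<noteq> 0"
  proof
    assume "w = 0"
    then have eqs: "r $ 2 * s $ 3 = r $ 3 * s $ 2" "r $ 3 * s $ 1 = r $ 1 * s $ 3" "r $ 1 * s $ 2 = r $ 2 * s $ 1"
      by (simp_all add: w_def vec_eq_iff forall_3 vector_3 flip: complex_cnj_mult complex_cnj_diff)
    then have "r $ k * s $ i = s $ k * r $ i" for i k
      using exhaust_3[of i] exhaust_3[of k] by (auto simp: mult.commute)
    moreover obtain k where "r $ k \<noteq> 0" using assms(1) by (auto simp: vec_eq_iff)
    ultimately have "s = (s $ k / r $ k) *s r"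
      by (simp add: vec_eq_iff field_simps)
    then show False using assms(2) by blast
  qed
  moreover have "\<exists>c. v = c *s w" if "cdot r v = 0" "cdot s v = 0" for v
  proof -
    have "cnj (r $ 1) * v $ 1 + cnj (r $ 2) * v $ 2 + cnj (r $ 3) * v $ 3 = 0"
      "cnj (s $ 1) * v $ 1 + cnj (s $ 2) * v $ 2 + cnj (s $ 3) * v $ 3 = 0"
      using that by (simp_all add: cdot_def sum_3)
    moreover have "v1 * (a3 * b1 - a1 * b3) = v2 * (a2 * b3 - a3 * b2)"
      if "a1 * v1 + a2 * v2 + a3 * v3 = 0" "b1 * v1 + b2 * v2 + b3 * v3 = 0"
      for a1 a2 a3 b1 b2 b3 v1 v2 v3 :: complex
    proof -
      have "v1 * (a3 * b1 - a1 * b3) - v2 * (a2 * b3 - a3 * b2)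
          = a3 * (b1 * v1 + b2 * v2 + b3 * v3) - b3 * (a1 * v1 + a2 * v2 + a3 * v3)"
        by (simp add: algebra_simps)
      then show ?thesis using that by simp
    qed
    ultimately have "v $ 1 * w $ 2 = v $ 2 * w $ 1" "v $ 2 * w $ 3 = v $ 3 * w $ 2" "v $ 3 * w $ 1 = v $ 1 * w $ 3"
      unfolding w_def vector_3 complex_cnj_diff complex_cnj_mult by (simp_all add: add_ac)
    then have "v $ i * w $ k = v $ k * w $ i" for i k
      using exhaust_3[of i] exhaust_3[of k] by auto
    moreover obtain k where "w $ k \<noteq> 0" using \<open>w \<noteq> 0\<close> by (auto simp: vec_eq_iff)
    ultimately have "v = (v $ k / w $ k) *s w"
      by (simp add: vec_eq_iff field_simps)
    then show ?thesis by blast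
  qed
  ultimately show ?thesis by (rule that)
qed

lemma orthogonal_not_parallel:
  assumes "k \<noteq> 0" "p \<noteq> 0" "cdot k p = 0"
  shows "p \<noteq> c *s k"
proof
  assume "p = c *s k"
  moreover from this have "c * cdot k k = 0" using assms(3) by (simp add: cdot_simps)
  ultimately show False using assms by auto
qed

text \<open>The range is orthogonal to the kernel. A second kernel direction \<open>p\<close> leaves
  only a line for the range; without one the range is the whole complement of
  \<open>k\<close>.\<close>

lemma hpsd_range_or_rank_one:
  fixes R :: "complex^3^3"
  assumes R: "hpsd R" and k: "k \<noteq> 0" "R *v k = 0"
  shows "(\<forall>f. cdot k f = 0 \<longrightarrow> (\<exists>u. R *v u = f)) \<or> (\<exists>r. R = dyad r r)"
proof (cases "\<exists>p. p \<noteq> 0 \<and> R *v p = 0 \<and> cdot k p = 0")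
  case True
  then obtain p where p: "p \<noteq> 0" "R *v p = 0" "cdot k p = 0" by blast
  obtain w where w: "w \<noteq> 0" "\<And>v. cdot k v = 0 \<Longrightarrow> cdot p v = 0 \<Longrightarrow> \<exists>c. v = c *s w"
    using orthogonal_complement_line[OF k(1)] orthogonal_not_parallel[OF k(1) p(1,3)] by metis
  have "cdot k (R *v x) = 0" "cdot p (R *v x) = 0" for x
    using hpsd_cdot[OF R, of k x] hpsd_cdot[OF R, of p x] by (simp_all add: k p cdot_simps)
  then obtain r where "R = dyad r r"
    using hpsd_rank_one[OF R w(1)] w(2) by metis
  then show ?thesis by blast
next
  case False
  have kR: "cdot k (R *v x) = 0" for x
    using hpsd_cdot[OF R, of k x] by (simp add: k cdot_simps)
  \<comment> \<open>Adding \<open>dyad k k\<close> makes the matrix injective, hence onto; preimages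
    of vectors orthogonal to \<open>k\<close> are themselves orthogonal to \<open>k\<close>, where
    the added term vanishes.\<close>
  have vec: "(R + dyad k k) *v x = R *v x + cdot k x *s k" for x
    by (simp add: matrix_vector_mult_add_rdistrib dyad_mult_vec)
  have dot: "cdot k ((R + dyad k k) *v x) = cdot k x * cdot k k" for x
    by (simp add: vec cdot_simps kR)
  have inj: "x = 0" if "(R + dyad k k) *v x = 0" for x
  proof -
    have "cdot k x = 0" using dot[of x] that k(1) by (simp add: cdot_simps)
    moreover from this have "R *v x = 0" using that by (simp add: vec)
    ultimately show ?thesis using False by blast
  qed
  have "\<exists>u. R *v u = f" if "cdot k f = 0" for f
  proof -
    obtain u where u: "(R + dyad k k) *v u = f" using inj by (rule surj_of_inj)
    then have "cdot k u = 0" using dot[of u] that k(1) by simp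
    then show ?thesis using u by (auto simp: vec)
  qed
  then show ?thesis by blast
qed

text \<open>Turns membership in the line of \<open>r\<close> into two linear equations, which serve
  as rows of a determinant.\<close>

lemma orthogonal_basis_of_complement:
  fixes r :: "complex^3"
  assumes "r \<noteq> 0"
  obtains p q where "\<And>f. cdot p f = 0 \<Longrightarrow> cdot q f = 0 \<Longrightarrow> \<exists>c. f = c *s r"
proof -
  obtain p where p: "p \<noteq> 0" "cdot r p = 0" using orthogonal_vector[of r r] by metis
  obtain q where q: "q \<noteq> 0" "cdot r q = 0" "cdot p q = 0" using orthogonal_vector[of r p] by metis
  obtain w where w: "w \<noteq> 0" "\<And>v. cdot p v = 0 \<Longrightarrow> cdot q v = 0 \<Longrightarrow> \<exists>c. v = c *s w"
    using orthogonal_complement_line[OF p(1)] orthogonal_not_parallel[OF p(1) q(1,3)] by metis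
  have "cdot p r = 0" "cdot q r = 0" using p q cdot_eq_0_commute by blast+
  then obtain c where c: "r = c *s w" using w(2) by blast
  then have "c \<noteq> 0" using assms by auto
  have "\<exists>c. f = c *s r" if f: "cdot p f = 0" "cdot q f = 0" for f
  proof -
    obtain d where "f = d *s w" using w(2) f by blast
    then have "f = (d / c) *s r" using c \<open>c \<noteq> 0\<close> by (simp add: vector_smult_assoc)
    then show ?thesis by blast
  qed
  then show ?thesis by (rule that)
qed

text \<open>The conditions of \<open>prodvec_finite\<close> become three linear equations for
  \<open>f\<close>: two from \<open>p\<close> and \<open>q\<close>, linear in \<open>z\<close>, and
  one from \<open>k\<close>, linear in \<open>cnj z\<close>. They have a non-zero solution exactly
  when \<open>g z = 0\<close>.\<close>

lemma prodvec_rank_one_range: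
  fixes N C :: "complex^3^3"
  assumes "unit_ppt N C"
    and R: "C - cadj N ** N = dyad r r"
    and S: "\<And>f. cdot k f = 0 \<Longrightarrow> \<exists>u. (C - N ** cadj N) *v u = f"
  shows "prodvec (mat 1) N C"
proof -
  interpret unit_ppt N C by fact
  note R' = R[folded R_def] and S' = S[folded S_def]
  show ?thesis
  proof (cases "r = 0")
    case True
    then show ?thesis by (intro prodvec_trace_0) (simp add: R' trace_dyad cdot_simps)
  next
    case False
    have Rr: "R *v ((c / cdot r r) *s r) = c *s r" for c
      using False by (simp add: R' dyad_mult_vec cdot_simps)
    obtain p q where pq: "\<And>f. cdot p f = 0 \<Longrightarrow> cdot q f = 0 \<Longrightarrow> \<exists>c. f = c *s r"
      using False by (rule orthogonal_basis_of_complement) blast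
    define g where "g z = det (conj_rows (N *v p - cnj z *s p) (N *v q - cnj z *s q) (cadj N *v k - z *s k))" for z
    \<comment> \<open>The same determinant in the coordinate \<open>w = 1 / z\<close> at infinity,
      with the factors \<open>- z\<close>, \<open>- z\<close> and \<open>- cnj z\<close> taken out
      of the rows.\<close>
    define E where "E w = det (conj_rows (p - cnj w *s (N *v p)) (q - cnj w *s (N *v q)) (k - w *s (cadj N *v k)))" for w
    show ?thesis
    \<comment> \<open>A zero of \<open>E\<close> at 0 is a solution at infinity; otherwise
      \<open>odd_degree_zero\<close> gives a finite one.\<close>
    proof (cases "E 0 = 0")
      case True
      then obtain f where f: "f \<noteq> 0" "cdot p f = 0" "cdot q f = 0" "cdot k f = 0"
        by (auto simp: E_def elim: orthogonal_vector_of_det)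
      obtain c where "f = c *s r" using pq f by blast
      moreover obtain u where "S *v u = f" using S' f by blast
      ultimately show ?thesis using prodvec_infinite[OF f(1)] Rr by metis
    next
      case False
      have "g z = - (z * (z * cnj z)) * E (1 / z)" if "z \<noteq> 0" for z
        using that unfolding g_def E_def
        by (simp add: conj_rows_def cadj_def det_3 field_simps)
      moreover have "continuous_on UNIV g" "continuous_on UNIV E"
        unfolding g_def E_def conj_rows_def cadj_def det_3 by (auto intro!: continuous_intros)
      ultimately obtain z where "g z = 0"
        using odd_degree_zero[of g E] False by blast
      then obtain f where f: "f \<noteq> 0" "cdot (N *v p - cnj z *s p) f = 0" "cdot (N *v q - cnj z *s q) f = 0"
        "cdot (cadj N *v k - z *s k) f = 0"
        by (auto simp: g_def elim: orthogonal_vector_of_det)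
      have "cdot p (cadj N *v f - z *s f) = 0" "cdot q (cadj N *v f - z *s f) = 0"
        "cdot k (N *v f - cnj z *s f) = 0"
        using f by (simp_all add: cdot_simps cdot_cadj_right cdot_cadj_left)
      then obtain c u where "cadj N *v f - z *s f = c *s r" "S *v u = N *v f - cnj z *s f"
        using pq S' by metis
      then show ?thesis using prodvec_finite[OF f(1)] Rr by metis
    qed
  qed
qed

text \<open>If \<open>R\<close> or \<open>S\<close> is injective an eigenvector suffices. Otherwise
  each is of rank at most one or has a plane as range: two planes meet in a non-zero
  \<open>f\<close>, the mixed cases use the determinant argument (one of them after a partial
  transpose), and two matrices of rank at most one use the dilation.\<close>

lemma prodvec_unit_3:
  fixes N C :: "complex^3^3"
  assumes ppt: "ppt (mat 1) N C"
  shows "prodvec (mat 1) N C"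
proof -
  interpret unit_ppt N C by unfold_locales (rule ppt)
  interpret T: unit_ppt "cadj N" C by unfold_locales (rule ppt_cadj[OF ppt])
  show ?thesis
  proof (cases "\<exists>k l. k \<noteq> 0 \<and> R *v k = 0 \<and> l \<noteq> 0 \<and> S *v l = 0")
    case False
    then show ?thesis using prodvec_R_inj prodvec_S_inj by blast
  next
    case True
    then obtain k l where k: "k \<noteq> 0" "R *v k = 0" and l: "l \<noteq> 0" "S *v l = 0" by blast
    consider (full) "\<forall>f. cdot k f = 0 \<longrightarrow> (\<exists>u. R *v u = f)" "\<forall>f. cdot l f = 0 \<longrightarrow> (\<exists>u. S *v u = f)"
      | (R1) r where "R = dyad r r" "\<forall>f. cdot l f = 0 \<longrightarrow> (\<exists>u. S *v u = f)"
      | (S1) s where "S = dyad s s" "\<forall>f. cdot k f = 0 \<longrightarrow> (\<exists>u. R *v u = f)"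
      | (RS) r s where "R = dyad r r" "S = dyad s s"
      using hpsd_range_or_rank_one[OF hpsd_R k] hpsd_range_or_rank_one[OF hpsd_S l] by blast
    then show ?thesis
    proof cases
      case full
      obtain f where "f \<noteq> 0" "cdot k f = 0" "cdot l f = 0" by (rule orthogonal_vector)
      then show ?thesis using full prodvec_infinite by metis
    next
      case R1
      show ?thesis
        by (rule prodvec_rank_one_range[OF unit_ppt_axioms, where r=r and k=l])
          (use R1 in \<open>auto simp: R_def S_def\<close>)
    next
      case S1
      have "prodvec (mat 1) (cadj N) C"
        by (rule prodvec_rank_one_range[OF T.unit_ppt_axioms, where r=s and k=k])
          (use S1 in \<open>auto simp: R_def S_def\<close>)
      from prodvec_cadj[OF this] show ?thesis by simp
    next
      case RS
      show ?thesis
      proof (rule prodvec_rank_one[OF RS])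
        fix v w
        assume rs: "r \<noteq> 0" "\<And>c. s \<noteq> c *s r" and v: "v \<noteq> 0" "cdot r v = 0" "cdot s v = 0"
          and w: "cdot r w = 0" "cdot s w = 0"
        obtain x where "\<And>v. cdot r v = 0 \<Longrightarrow> cdot s v = 0 \<Longrightarrow> \<exists>c. v = c *s x"
          using rs by (rule orthogonal_complement_line) blast
        then obtain a b where ab: "v = a *s x" "w = b *s x" using v w by metis
        then have "w = (b / a) *s v" using v(1) by (auto simp: vector_smult_assoc)
        then show "\<exists>c. w = c *s v" by blast
      qed
    qed
  qed
qed

section \<open>Dimensions two and one, and the descent in dimension\<close>

lemma hpsd_rank_one_2:
  fixes R :: "complex^2^2"
  assumes R: "hpsd R" and k: "k \<noteq> 0" "R *v k = 0"
  obtains r where "R = dyad r r"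
proof -
  \<comment> \<open>\<open>e\<close> spans the orthogonal complement of \<open>k\<close>, which
    contains the range of \<open>R\<close>.\<close>
  define e :: "complex^2" where "e = vector [- cnj (k $ 2), cnj (k $ 1)]"
  have "e \<noteq> 0" using k(1) by (auto simp: e_def vec_eq_iff forall_2 vector_2)
  have "\<exists>c. R *v x = c *s e" for x
  proof -
    define v where "v = R *v x"
    have "cdot k v = 0" using hpsd_cdot[OF R, of k x] by (simp add: k cdot_simps v_def)
    then have "cnj (k $ 1) * v $ 1 + cnj (k $ 2) * v $ 2 = 0" by (simp add: cdot_def sum_2)
    then have "v $ 1 * e $ 2 = v $ 2 * e $ 1" by (simp add: e_def vector_2 eq_neg_iff_add_eq_0 mult.commute)
    then have "v $ i * e $ j = v $ j * e $ i" for i j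
      using exhaust_2[of i] exhaust_2[of j] by auto
    moreover obtain j where "e $ j \<noteq> 0" using \<open>e \<noteq> 0\<close> by (auto simp: vec_eq_iff)
    ultimately have "v = (v $ j / e $ j) *s e" by (simp add: vec_eq_iff field_simps)
    then show ?thesis unfolding v_def by blast
  qed
  then show ?thesis using hpsd_rank_one[OF R \<open>e \<noteq> 0\<close>] that by metis
qed

lemma prodvec_unit_2:
  fixes N C :: "complex^2^2"
  assumes ppt: "ppt (mat 1) N C"
  shows "prodvec (mat 1) N C"
proof -
  interpret unit_ppt N C by unfold_locales (rule ppt)
  show ?thesis
  proof (cases "\<exists>k l. k \<noteq> 0 \<and> R *v k = 0 \<and> l \<noteq> 0 \<and> S *v l = 0")
    case False
    then show ?thesis using prodvec_R_inj prodvec_S_inj by blast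
  next
    case True
    then obtain r s where RS: "R = dyad r r" "S = dyad s s"
      using hpsd_rank_one_2[OF hpsd_R] hpsd_rank_one_2[OF hpsd_S] by metis
    show ?thesis
    proof (rule prodvec_rank_one[OF RS])
      fix v w
      assume rs: "r \<noteq> 0" "\<And>c. s \<noteq> c *s r" and v: "v \<noteq> 0" "cdot r v = 0" "cdot s v = 0"
      have "cnj (r $ 1) * v $ 1 + cnj (r $ 2) * v $ 2 = 0" "cnj (s $ 1) * v $ 1 + cnj (s $ 2) * v $ 2 = 0"
        using v by (simp_all add: cdot_def sum_2)
      \<comment> \<open>Cramer's rule: a non-zero \<open>v\<close> orthogonal to both forces the
        determinant of \<open>r\<close> and \<open>s\<close> to vanish, contradicting independence.
        The hypothesis \<open>par\<close> thus holds vacuously.\<close>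
      moreover have "v $ 1 * cnj (r $ 1 * s $ 2 - r $ 2 * s $ 1)
          = cnj (s $ 2) * (cnj (r $ 1) * v $ 1 + cnj (r $ 2) * v $ 2)
          - cnj (r $ 2) * (cnj (s $ 1) * v $ 1 + cnj (s $ 2) * v $ 2)"
        "v $ 2 * cnj (r $ 1 * s $ 2 - r $ 2 * s $ 1)
          = cnj (r $ 1) * (cnj (s $ 1) * v $ 1 + cnj (s $ 2) * v $ 2)
          - cnj (s $ 1) * (cnj (r $ 1) * v $ 1 + cnj (r $ 2) * v $ 2)"
        by (simp_all add: algebra_simps)
      ultimately have "v $ 1 * cnj (r $ 1 * s $ 2 - r $ 2 * s $ 1) = 0" "v $ 2 * cnj (r $ 1 * s $ 2 - r $ 2 * s $ 1) = 0"
        by (simp_all only: mult_zero_right diff_self)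
      then have "cnj (r $ 1 * s $ 2 - r $ 2 * s $ 1) = 0"
        using v(1) by (auto simp: vec_eq_iff forall_2)
      then have "r $ 1 * s $ 2 = r $ 2 * s $ 1" by (simp flip: complex_cnj_mult complex_cnj_diff)
      then have "r $ j * s $ i = s $ j * r $ i" for i j
        using exhaust_2[of i] exhaust_2[of j] by (auto simp: mult.commute)
      moreover obtain j where "r $ j \<noteq> 0" using rs(1) by (auto simp: vec_eq_iff)
      ultimately have "s = (s $ j / r $ j) *s r" by (simp add: vec_eq_iff field_simps)
      then show "\<exists>c. w = c *s v" using rs(2) by blast
    qed
  qed
qed

lemma matrix_1_kernel:
  fixes M :: "complex^1^1"
  assumes "f \<noteq> 0" "M *v f = 0"
  shows "M = 0"
  using assms by (auto simp: vec_eq_iff forall_1 matrix_vector_mult_def)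

lemma prodvec_unit_1:
  fixes N C :: "complex^1^1"
  assumes ppt: "ppt (mat 1) N C"
  shows "prodvec (mat 1) N C"
proof -
  interpret unit_ppt N C by unfold_locales (rule ppt)
  show ?thesis
  proof (cases "\<exists>k. k \<noteq> 0 \<and> R *v k = 0")
    case True
    then have "R = 0" using matrix_1_kernel by blast
    then show ?thesis by (intro prodvec_trace_0) (simp add: trace_def)
  qed (use prodvec_R_inj in blast)
qed

text \<open>In dimension one a common kernel vector would make all three blocks zero.\<close>

lemma prodvec_1:
  fixes A B C :: "complex^1^1"
  assumes "ppt A B C" "(A, B, C) \<noteq> (0, 0, 0)"
  shows "prodvec A B C"
  using prodvec_reduce[OF prodvec_unit_1 assms(1)] assms(2) matrix_1_kernel by blast

lemma prodvec_2:
  fixes A B C :: "complex^2^2"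
  assumes "ppt A B C" "(A, B, C) \<noteq> (0, 0, 0)"
  shows "prodvec A B C"
  using prodvec_step[OF prodvec_unit_2 prodvec_1 _ assms] by simp

lemma prodvec_3:
  fixes A B C :: "complex^3^3"
  assumes "ppt A B C" "(A, B, C) \<noteq> (0, 0, 0)"
  shows "prodvec A B C"
  using prodvec_step[OF prodvec_unit_3 prodvec_2 _ assms] by simp

text \<open>The Stormer--Woronowicz theorem for two by three systems, in block form.\<close>

theorem ppt_imp_sep:
  fixes A B C :: "complex^3^3"
  assumes "ppt A B C"
  shows "sep A B C"
  using prodvec_3 assms by (rule sep_of_prodvec)

section \<open>Transfer to block matrices\<close>

notation vec_index (infixl \<open>$\<^sub>v\<close> 100)

text \<open>Matches the elements 1, 2, 3 of the index type, in this order, with the positions 0, 1,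
  2; in that type \<open>3\<close> and \<open>0\<close> are the same element.\<close>

definition ix3 :: "3 \<Rightarrow> nat" where
  "ix3 i = (if i = 1 then 0 else if i = 2 then 1 else 2)"

lemma ix3_simps [simp]: "ix3 1 = 0" "ix3 2 = 1" "ix3 3 = 2"
  by (simp_all add: ix3_def)

lemma ix3_less [simp]: "ix3 i < 3"
  by (simp add: ix3_def)

definition the3 :: "nat \<Rightarrow> 3" where
  "the3 a = (if a = 0 then 1 else if a = 1 then 2 else 3)"

lemma the3_ix3 [simp]: "the3 (ix3 i) = i"
  using exhaust_3[of i] by (auto simp: the3_def)

lemma ix3_the3: "a < 3 \<Longrightarrow> ix3 (the3 a) = a"
  by (auto simp: the3_def)

lemma sum_less_6: "(\<Sum>i<2 * 3. f i) = (\<Sum>k\<in>UNIV. f (ix3 k)) + (\<Sum>k\<in>UNIV. f (3 + ix3 k))"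
  for f :: "nat \<Rightarrow> complex"
  by (simp add: sum_3 numeral_eq_Suc algebra_simps)

lemma psd_hermitian: "psd N X \<Longrightarrow> i < N \<Longrightarrow> j < N \<Longrightarrow> cnj (X $$ (i, j)) = X $$ (j, i)"
  unfolding psd_def by (blast intro: sym)

lemma psd_form_nonneg:
  assumes "psd N X" "v \<in> carrier_vec N"
  shows "0 \<le> Re (\<Sum>i<N. \<Sum>j<N. cnj (v $\<^sub>v i) * X $$ (i, j) * v $\<^sub>v j)"
  using assms unfolding psd_def Let_def by blast

text \<open>The form of the conjugate matrix at \<open>v\<close> is the conjugate of the form of
  \<open>X\<close> at the conjugate of \<open>v\<close>. This undoes a full transposition of a
  Hermitian matrix.\<close>

lemma psd_cnj:
  assumes X: "psd N X"
  shows "psd N (Matrix.mat N N (\<lambda>(i, j). cnj (X $$ (i, j))))"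
proof -
  have "Im (\<Sum>i<N. \<Sum>j<N. cnj (v $\<^sub>v i) * cnj (X $$ (i, j)) * v $\<^sub>v j) = 0
      \<and> 0 \<le> Re (\<Sum>i<N. \<Sum>j<N. cnj (v $\<^sub>v i) * cnj (X $$ (i, j)) * v $\<^sub>v j)"
    if v: "v \<in> carrier_vec N" for v
  proof -
    define u where "u = Matrix.vec N (\<lambda>i. cnj (v $\<^sub>v i))"
    define q where "q = (\<Sum>i<N. \<Sum>j<N. cnj (u $\<^sub>v i) * X $$ (i, j) * u $\<^sub>v j)"
    have "u \<in> carrier_vec N" by (simp add: u_def)
    then have "Im q = 0" "0 \<le> Re q" using X unfolding psd_def Let_def q_def by blast+
    moreover have "(\<Sum>i<N. \<Sum>j<N. cnj (v $\<^sub>v i) * cnj (X $$ (i, j)) * v $\<^sub>v j) = cnj q"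
      by (simp add: q_def u_def)
    ultimately show ?thesis by simp
  qed
  then show ?thesis
    using psd_hermitian[OF X] by (simp add: psd_def Let_def)
qed

lemma psd_outer:
  assumes "a \<in> carrier_vec N"
  shows "psd N (outer a)"
proof -
  have "(\<Sum>i<N. \<Sum>j<N. cnj (v $\<^sub>v i) * outer a $$ (i, j) * v $\<^sub>v j)
      = (\<Sum>i<N. cnj (v $\<^sub>v i) * a $\<^sub>v i) * cnj (\<Sum>i<N. cnj (v $\<^sub>v i) * a $\<^sub>v i)" for v
    using assms by (simp add: outer_def sum_product mult_ac)
  then have "(\<Sum>i<N. \<Sum>j<N. cnj (v $\<^sub>v i) * outer a $$ (i, j) * v $\<^sub>v j)
      = of_real ((cmod (\<Sum>i<N. cnj (v $\<^sub>v i) * a $\<^sub>v i))\<^sup>2)" for v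
    by (simp only: complex_norm_square)
  then show ?thesis
    using assms by (simp add: psd_def Let_def) (simp add: outer_def)
qed

lemma psd_block_form:
  fixes A B C :: "complex^3^3"
  assumes X: "psd (2 * 3) X"
    and A: "\<And>i j. A $ i $ j = X $$ (ix3 i, ix3 j)"
    and B: "\<And>i j. B $ i $ j = X $$ (ix3 i, 3 + ix3 j)"
    and C: "\<And>i j. C $ i $ j = X $$ (3 + ix3 i, 3 + ix3 j)"
  shows "cadj A = A" "cadj C = C" "0 \<le> inner w (bop A B C w)"
proof -
  have lt: "ix3 i < 2 * 3" "3 + ix3 i < 2 * 3" for i
    using ix3_less[of i] by linarith+
  note h = psd_hermitian[OF X]
  show "cadj A = A" "cadj C = C"
    using lt h by (simp_all add: cadj_def vec_eq_iff A C)
  have B': "cadj B $ i $ j = X $$ (3 + ix3 i, ix3 j)" for i j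
    using lt h by (simp add: cadj_def B)
  define v where "v = Matrix.vec (2 * 3) (\<lambda>r. if r < 3 then fst w $ the3 r else snd w $ the3 (r - 3))"
  have "ix3 i < 6" for i
    using ix3_less[of i] by linarith
  then have v: "v $\<^sub>v ix3 i = fst w $ i" "v $\<^sub>v (3 + ix3 i) = snd w $ i" for i
    using lt[of i] by (simp_all add: v_def)
  have eq: "(\<Sum>i<2*3. \<Sum>j<2*3. cnj (v $\<^sub>v i) * X $$ (i, j) * v $\<^sub>v j)
      = cdot (fst w) (A *v fst w) + cdot (fst w) (B *v snd w)
        + cdot (snd w) (cadj B *v fst w) + cdot (snd w) (C *v snd w)"
    unfolding sum_less_6
    by (simp add: v cdot_def matrix_vector_mult_def sum_distrib_left sum.distrib mult.assoc
        flip: A B C B')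
  have "v \<in> carrier_vec (2 * 3)" by (simp add: v_def)
  from psd_form_nonneg[OF X this, unfolded eq] show "0 \<le> inner w (bop A B C w)"
    unfolding inner_bop_pair .
qed

definition to_matrix3 :: "complex mat \<Rightarrow> complex^3^3" where
  "to_matrix3 X = (\<chi> i j. X $$ (ix3 i, ix3 j))"

definition ketbra :: "complex Matrix.vec \<Rightarrow> complex Matrix.vec \<Rightarrow> complex mat" where
  "ketbra x y = Matrix.mat 3 3 (\<lambda>(a, b). x $\<^sub>v a * cnj (y $\<^sub>v b))"

lemma ketbra_carrier [simp]: "ketbra x y \<in> carrier_mat 3 3"
  by (simp add: ketbra_def)

text \<open>The map acts on the rank-one matrix of \<open>v\<close>, which stacks \<open>y\<close>
  on \<open>z\<close> and has the four \<open>ketbra\<close> matrices as blocks.\<close>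

lemma ppt_of_PPT_map:
  assumes "PPT_map \<phi>" and y: "y \<in> carrier_vec 3" "z \<in> carrier_vec 3"
  shows "ppt (to_matrix3 (\<phi> (ketbra y y))) (to_matrix3 (\<phi> (ketbra y z))) (to_matrix3 (\<phi> (ketbra z z)))"
    "to_matrix3 (\<phi> (ketbra z y)) = cadj (to_matrix3 (\<phi> (ketbra y z)))"
proof -
  define v where "v = Matrix.vec (2 * 3) (\<lambda>r. if r < 3 then y $\<^sub>v r else z $\<^sub>v (r - 3))"
  have "psd (2 * 3) (outer v)" by (rule psd_outer) (simp add: v_def)
  then have X: "psd (2 * 3) (id_tensor 2 \<phi> (outer v))"
    and X': "psd (2 * 3) (id_tensor 2 (\<lambda>X. transpose_mat (\<phi> X)) (outer v))"
    using assms(1) unfolding PPT_map_def completely_copositive_def completely_positive_def by blast+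
  have car: "\<phi> M \<in> carrier_mat 3 3" if "M \<in> carrier_mat 3 3" for M
    using assms(1) that by (auto simp: PPT_map_def completely_positive_def linear_map3_def)
  have blocks: "block3 (outer v) 0 0 = ketbra y y" "block3 (outer v) 0 1 = ketbra y z"
    "block3 (outer v) 1 0 = ketbra z y" "block3 (outer v) 1 1 = ketbra z z"
    by (auto simp: block3_def ketbra_def outer_def v_def)
  have dm: "ix3 i div 3 = 0" "ix3 i mod 3 = ix3 i" "(3 + ix3 i) div 3 = 1" "(3 + ix3 i) mod 3 = ix3 i"
    "ix3 i < 6" "3 + ix3 i < 6" for i
    using exhaust_3[of i] by auto
  let ?P = "\<lambda>y z. to_matrix3 (\<phi> (ketbra y z))"
  have e: "?P y y $ i $ j = id_tensor 2 \<phi> (outer v) $$ (ix3 i, ix3 j)"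
    "?P y z $ i $ j = id_tensor 2 \<phi> (outer v) $$ (ix3 i, 3 + ix3 j)"
    "?P z y $ i $ j = id_tensor 2 \<phi> (outer v) $$ (3 + ix3 i, ix3 j)"
    "?P z z $ i $ j = id_tensor 2 \<phi> (outer v) $$ (3 + ix3 i, 3 + ix3 j)" for i j
    by (simp_all add: to_matrix3_def id_tensor_def dm blocks[simplified])
  have herm: "cnj (?P y y $ i $ j) = ?P y y $ j $ i" "cnj (?P y z $ i $ j) = ?P z y $ j $ i"
    "cnj (?P z z $ i $ j) = ?P z z $ j $ i" for i j
    by (simp_all only: e, (rule psd_hermitian[OF X]; simp add: dm)+)
  show adj: "?P z y = cadj (?P y z)"
    by (simp add: vec_eq_iff cadj_def herm)
  \<comment> \<open>Copositivity transposes each block in place; conjugating all entries then turns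
    the blocks into adjoints, so that exactly the two off-diagonal blocks are exchanged.\<close>
  let ?Z = "Matrix.mat (2 * 3) (2 * 3) (\<lambda>(i, j). cnj (id_tensor 2 (\<lambda>X. transpose_mat (\<phi> X)) (outer v) $$ (i, j)))"
  have Z: "psd (2 * 3) ?Z" by (rule psd_cnj[OF X'])
  have tr: "transpose_mat (\<phi> (ketbra y z)) $$ (ix3 i, ix3 j) = ?P y z $ j $ i" for i j y z
    using car[OF ketbra_carrier[of y z]] ix3_less[of i] ix3_less[of j] by (simp add: to_matrix3_def)
  have e': "?P y y $ i $ j = ?Z $$ (ix3 i, ix3 j)"
    "?P z y $ i $ j = ?Z $$ (ix3 i, 3 + ix3 j)"
    "?P z z $ i $ j = ?Z $$ (3 + ix3 i, 3 + ix3 j)" for i j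
    by (simp_all add: id_tensor_def dm blocks[simplified] tr herm)
  show "ppt (?P y y) (?P y z) (?P z z)"
    unfolding ppt_def adj[symmetric]
    using psd_block_form[OF X e(1,2,4)] psd_block_form(3)[OF Z e'] by blast
qed

section \<open>Assembling separable decompositions\<close>

inductive sepfun :: "nat \<Rightarrow> (nat \<times> nat \<Rightarrow> complex) \<Rightarrow> bool" for n where
  sepfun_zero: "sepfun n (\<lambda>_. 0)"
| sepfun_add: "sepfun n h \<Longrightarrow> psd n \<alpha> \<Longrightarrow> psd 3 \<beta> \<Longrightarrow> sepfun n (\<lambda>rc. h rc + kron_mat \<alpha> \<beta> $$ rc)"

lemma sepfun_plus:
  assumes "sepfun n h" "sepfun n g"
  shows "sepfun n (\<lambda>rc. g rc + h rc)"
  using assms(1)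
proof induction
  case sepfun_zero
  then show ?case using assms(2) by simp
next
  case (sepfun_add h \<alpha> \<beta>)
  from sepfun.sepfun_add[OF sepfun_add.IH sepfun_add.hyps(2,3)] show ?case
    by (simp add: add.assoc)
qed

lemma sepfun_sum:
  assumes "\<And>k. k < (K::nat) \<Longrightarrow> sepfun n (h k)"
  shows "sepfun n (\<lambda>rc. \<Sum>k<K. h k rc)"
  using assms by (induction K) (auto intro: sepfun_zero sepfun_plus)

lemma sepfun_lists:
  assumes "sepfun n h"
  shows "\<exists>\<alpha>s \<beta>s. length \<alpha>s = length \<beta>s \<and> (\<forall>\<alpha> \<in> set \<alpha>s. psd n \<alpha>) \<and> (\<forall>\<beta> \<in> set \<beta>s. psd 3 \<beta>)
    \<and> h = (\<lambda>rc. \<Sum>j<length \<alpha>s. kron_mat (\<alpha>s ! j) (\<beta>s ! j) $$ rc)"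
  using assms
proof induction
  case sepfun_zero
  then show ?case by (intro exI[of _ "[]"]) simp
next
  case (sepfun_add h \<alpha> \<beta>)
  then obtain \<alpha>s \<beta>s where l: "length \<alpha>s = length \<beta>s" "\<forall>\<alpha> \<in> set \<alpha>s. psd n \<alpha>" "\<forall>\<beta> \<in> set \<beta>s. psd 3 \<beta>"
    "h = (\<lambda>rc. \<Sum>j<length \<alpha>s. kron_mat (\<alpha>s ! j) (\<beta>s ! j) $$ rc)"
    by blast
  show ?case
    by (rule exI[of _ "\<alpha>s @ [\<alpha>]"], rule exI[of _ "\<beta>s @ [\<beta>]"])
      (use l sepfun_add.hyps in \<open>auto simp: nth_append\<close>)
qed

text \<open>The entry function \<open>h\<close> need only agree with \<sigma> at valid positions;
  its values elsewhere are discarded when the matrix is formed.\<close>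

lemma separableI:
  assumes "psd (n * 3) \<sigma>" "sepfun n h" "\<And>r c. r < n * 3 \<Longrightarrow> c < n * 3 \<Longrightarrow> \<sigma> $$ (r, c) = h (r, c)"
  shows "separable n 3 \<sigma>"
proof -
  obtain \<alpha>s \<beta>s where l: "length \<alpha>s = length \<beta>s" "\<forall>\<alpha> \<in> set \<alpha>s. psd n \<alpha>" "\<forall>\<beta> \<in> set \<beta>s. psd 3 \<beta>"
    "h = (\<lambda>rc. \<Sum>j<length \<alpha>s. kron_mat (\<alpha>s ! j) (\<beta>s ! j) $$ rc)"
    using sepfun_lists[OF assms(2)] by blast
  have "\<sigma> \<in> carrier_mat (n * 3) (n * 3)"
    using assms(1) unfolding psd_def by blast
  then have "\<sigma> = Matrix.mat (n * 3) (n * 3) h"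
    using assms(3) by auto
  then show ?thesis
    unfolding separable_def using assms(1) l by blast
qed

text \<open>The local operator with columns \<open>x\<close> and \<open>x'\<close> maps the first
  factor into dimension \<open>n\<close>; it sends the product term of \<open>(a, b)\<close> and
  \<open>f\<close> to that of \<open>a * x + b * x'\<close> and \<open>f\<close>.\<close>

lemma sepfun_of_sep:
  assumes "sep A B C"
  shows "\<exists>h. sepfun n h \<and> (\<forall>i<n. \<forall>j<n. \<forall>a<3. \<forall>b<3. h (3 * i + a, 3 * j + b) =
     x i * cnj (x j) * A $ the3 a $ the3 b + x i * cnj (x' j) * B $ the3 a $ the3 b
     + x' i * cnj (x j) * cadj B $ the3 a $ the3 b + x' i * cnj (x' j) * C $ the3 a $ the3 b)"
  using assms
proof induction
  case sep_zero
  then show ?case by (intro exI[of _ "\<lambda>_. 0"]) (simp add: sepfun_zero)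
next
  case (sep_add A B C s f t)
  then obtain h where h: "sepfun n h" "\<And>i j a b. i < n \<Longrightarrow> j < n \<Longrightarrow> a < 3 \<Longrightarrow> b < 3 \<Longrightarrow> h (3 * i + a, 3 * j + b) =
     x i * cnj (x j) * A $ the3 a $ the3 b + x i * cnj (x' j) * B $ the3 a $ the3 b
     + x' i * cnj (x j) * cadj B $ the3 a $ the3 b + x' i * cnj (x' j) * C $ the3 a $ the3 b"
    by blast
  define g where "g = Matrix.vec n (\<lambda>i. s * x i + t * x' i)"
  define u where "u = Matrix.vec 3 (\<lambda>a. f $ the3 a)"
  have "psd n (outer g)" "psd 3 (outer u)"
    by (rule psd_outer; simp add: g_def u_def)+
  from sepfun_add[OF h(1) this]
  have "sepfun n (\<lambda>rc. h rc + kron_mat (outer g) (outer u) $$ rc)" .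
  moreover have kron: "kron_mat (outer g) (outer u) $$ (3 * i + a, 3 * j + b)
      = (s * x i + t * x' i) * cnj (s * x j + t * x' j) * (f $ the3 a * cnj (f $ the3 b))"
    if "i < n" "j < n" "a < 3" "b < 3" for i j a b
  proof -
    have "3 * i + a < n * 3" "3 * j + b < n * 3" using that by linarith+
    then show ?thesis using that by (simp add: kron_mat_def outer_def g_def u_def)
  qed
  ultimately show ?case
    by (intro exI[of _ "\<lambda>rc. h rc + kron_mat (outer g) (outer u) $$ rc"])
      (simp add: h(2) kron cadj_def dyad_def, simp add: distrib_left distrib_right mult_ac add_ac)
qed

lemma schmidt_rank_le_2:
  assumes "schmidt_rank_le n 3 2 a"
  obtains x x' y y' where "y \<in> carrier_vec 3" "y' \<in> carrier_vec 3"
    "\<And>i c. i < n \<Longrightarrow> c < 3 \<Longrightarrow> a $\<^sub>v (3 * i + c) = x i * y $\<^sub>v c + x' i * y' $\<^sub>v c"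
proof -
  obtain xs ys where l: "length xs = length ys" "length xs \<le> 2"
    and car: "set xs \<subseteq> carrier_vec n" "set ys \<subseteq> carrier_vec 3"
    and a: "a = Matrix.vec (n * 3) (\<lambda>r. \<Sum>j<length xs. kron_vec (xs ! j) (ys ! j) $\<^sub>v r)"
    using assms unfolding schmidt_rank_le_def by blast
  \<comment> \<open>Decompositions with fewer than two terms are padded with zeros.\<close>
  define x y where "x p i = (if p < length xs then xs ! p $\<^sub>v i else 0)"
    and "y p = (if p < length xs then ys ! p else 0\<^sub>v 3)" for p i
  have y: "y p \<in> carrier_vec 3" for p
    using car(2) l(1) by (auto simp: y_def)
  have "a $\<^sub>v (3 * i + c) = x 0 i * y 0 $\<^sub>v c + x 1 i * y 1 $\<^sub>v c" if ic: "i < n" "c < 3" for i c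
  proof -
    have r: "3 * i + c < n * 3" using ic by linarith
    have "kron_vec (xs ! j) (ys ! j) $\<^sub>v (3 * i + c) = xs ! j $\<^sub>v i * ys ! j $\<^sub>v c" if "j < length xs" for j
    proof -
      have "xs ! j \<in> carrier_vec n" "ys ! j \<in> carrier_vec 3" using car l(1) that by auto
      then show ?thesis using r ic by (simp add: kron_vec_def)
    qed
    then have "a $\<^sub>v (3 * i + c) = (\<Sum>j<length xs. x j i * y j $\<^sub>v c)"
      using r by (simp add: a x_def y_def)
    also have "\<dots> = (\<Sum>j<2. x j i * y j $\<^sub>v c)"
      by (rule sum.mono_neutral_left) (use l(2) in \<open>auto simp: x_def\<close>)
    finally show ?thesis by (simp add: numeral_2_eq_2)
  qed
  then show ?thesis using y that by blast
qed

section \<open>Linear expansion of the map and the final assembly\<close>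

lemma linear_map3_sum:
  assumes \<phi>: "linear_map3 \<phi>" and M: "\<And>k. k < (K::nat) \<Longrightarrow> M k \<in> carrier_mat 3 3" and "a < 3" "b < 3"
  shows "\<phi> (Matrix.mat 3 3 (\<lambda>rc. \<Sum>k<K. c k * M k $$ rc)) $$ (a, b) = (\<Sum>k<K. c k * \<phi> (M k) $$ (a, b))"
proof -
  have "\<phi> (Matrix.mat 3 3 (\<lambda>rc. \<Sum>k<K. c k * M k $$ rc)) = Matrix.mat 3 3 (\<lambda>rc. \<Sum>k<K. c k * \<phi> (M k) $$ rc)"
    using M
  proof (induction K)
    case 0
    have "\<phi> (0 \<cdot>\<^sub>m 0\<^sub>m 3 3) = 0 \<cdot>\<^sub>m \<phi> (0\<^sub>m 3 3)" and car: "\<phi> (0\<^sub>m 3 3) \<in> carrier_mat 3 3"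
      using \<phi> zero_carrier_mat[of 3 3] unfolding linear_map3_def by blast+
    moreover have "0 \<cdot>\<^sub>m 0\<^sub>m 3 3 = (Matrix.mat 3 3 (\<lambda>rc. 0) :: complex mat)"
      by (intro eq_matI) auto
    moreover have "0 \<cdot>\<^sub>m \<phi> (0\<^sub>m 3 3) = Matrix.mat 3 3 (\<lambda>rc. 0)"
      using car by (intro eq_matI) auto
    ultimately show ?case by simp
  next
    case (Suc K)
    have car: "M K \<in> carrier_mat 3 3" "\<phi> (M K) \<in> carrier_mat 3 3"
      using \<phi> Suc.prems by (auto simp: linear_map3_def)
    let ?S = "Matrix.mat 3 3 (\<lambda>rc. \<Sum>k<K. c k * M k $$ rc)"
    have "Matrix.mat 3 3 (\<lambda>rc. \<Sum>k<Suc K. c k * M k $$ rc) = ?S + c K \<cdot>\<^sub>m M K"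
      using car by auto
    then have "\<phi> (Matrix.mat 3 3 (\<lambda>rc. \<Sum>k<Suc K. c k * M k $$ rc)) = \<phi> ?S + c K \<cdot>\<^sub>m \<phi> (M K)"
      using \<phi> car by (simp add: linear_map3_def)
    also have "\<phi> ?S = Matrix.mat 3 3 (\<lambda>rc. \<Sum>k<K. c k * \<phi> (M k) $$ rc)"
      using Suc by simp
    finally show ?case using car by auto
  qed
  then show ?thesis using assms(3,4) by simp
qed

lemma linear_map3_block_outer:
  assumes \<phi>: "linear_map3 \<phi>"
    and a: "\<And>i c. i < n \<Longrightarrow> c < 3 \<Longrightarrow> a $\<^sub>v (3 * i + c) = x i * y $\<^sub>v c + x' i * y' $\<^sub>v c"
    and dim: "a \<in> carrier_vec (n * 3)"
    and ij: "i < n" "j < n" and pq: "p < 3" "q < 3"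
  shows "\<phi> (block3 (outer a) i j) $$ (p, q) =
     x i * cnj (x j) * \<phi> (ketbra y y) $$ (p, q) + x i * cnj (x' j) * \<phi> (ketbra y y') $$ (p, q)
     + x' i * cnj (x j) * \<phi> (ketbra y' y) $$ (p, q) + x' i * cnj (x' j) * \<phi> (ketbra y' y') $$ (p, q)"
proof -
  define c where "c = (!) [x i * cnj (x j), x i * cnj (x' j), x' i * cnj (x j), x' i * cnj (x' j)]"
  define M where "M = (!) [ketbra y y, ketbra y y', ketbra y' y, ketbra y' y']"
  have sum4: "(\<Sum>k<4. f k) = f 0 + f 1 + f 2 + f 3" for f :: "nat \<Rightarrow> complex"
    by (simp add: numeral_eq_Suc)
  have M: "M k \<in> carrier_mat 3 3" if "k < 4" for k
  proof -
    have "k = 0 \<or> k = 1 \<or> k = 2 \<or> k = 3" using that by arith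
    then show ?thesis by (auto simp: M_def)
  qed
  have lt: "3 * i + c < n * 3" "3 * j + c < n * 3" if "c < 3" for c
    using ij that by linarith+
  have "block3 (outer a) i j = Matrix.mat 3 3 (\<lambda>rc. \<Sum>k<4. c k * M k $$ rc)"
    unfolding block3_def
    using dim lt ij by (auto simp: sum4 c_def M_def outer_def ketbra_def a intro!: eq_matI)
      (simp add: distrib_left distrib_right mult_ac add_ac)
  then have "\<phi> (block3 (outer a) i j) $$ (p, q) = (\<Sum>k<4. c k * \<phi> (M k) $$ (p, q))"
    using linear_map3_sum[OF \<phi> M pq] by simp
  then show ?thesis by (simp add: sum4 c_def M_def)
qed

theorem theorem3:
  fixes n :: nat and \<phi>1 \<phi>2 :: "complex mat \<Rightarrow> complex mat" and \<rho> :: "complex mat"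
  assumes "PPT_map \<phi>1"
    and "completely_positive \<phi>2"
    and "is_state (n * 3) \<rho>"
    and "schmidt_number_le n 3 2 (id_tensor n \<phi>2 \<rho>)"
  shows "separable n 3 (id_tensor n (\<phi>1 \<circ> \<phi>2) \<rho>)"
proof -
  define \<sigma> where "\<sigma> = id_tensor n \<phi>2 \<rho>"
  have lin1: "linear_map3 \<phi>1" and lin2: "linear_map3 \<phi>2"
    using assms by (auto simp: PPT_map_def completely_positive_def)
  have block: "block3 \<sigma> i j = \<phi>2 (block3 \<rho> i j)" if "i < n" "j < n" for i j
  proof -
    have "block3 \<rho> i j \<in> carrier_mat 3 3" by (simp add: block3_def)
    then have "\<phi>2 (block3 \<rho> i j) \<in> carrier_mat 3 3" using lin2 by (simp add: linear_map3_def)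
    moreover have "3 * i + a < n * 3" "3 * j + a < n * 3" if "a < 3" for a
      using \<open>i < n\<close> \<open>j < n\<close> that by linarith+
    ultimately show ?thesis by (auto simp: block3_def \<sigma>_def id_tensor_def)
  qed
  have out: "id_tensor n (\<phi>1 \<circ> \<phi>2) \<rho> = id_tensor n \<phi>1 \<sigma>"
    unfolding id_tensor_def
    by (rule cong_mat) (auto simp: block less_mult_imp_div_less)
  have "psd (n * 3) \<sigma>" using assms(4) by (simp add: schmidt_number_le_def \<sigma>_def)
  then have psd: "psd (n * 3) (id_tensor n \<phi>1 \<sigma>)"
    using assms(1) by (simp add: PPT_map_def completely_positive_def)
  obtain ps as where len: "length ps = length as" and ps: "\<forall>p \<in> set ps. p \<ge> (0::real)"
    and as: "\<forall>a \<in> set as. a \<in> carrier_vec (n * 3) \<and> schmidt_rank_le n 3 2 a"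
    and \<sigma>: "\<sigma> = Matrix.mat (n * 3) (n * 3)
      (\<lambda>rc. \<Sum>j<length as. (complex_of_real (ps ! j) \<cdot>\<^sub>m outer (as ! j)) $$ rc)"
    using assms(4) unfolding schmidt_number_le_def \<sigma>_def[symmetric] by blast
  \<comment> \<open>Each vector of Schmidt rank at most two is handled separately: the map acts on
    the two right-hand factors, and \<open>ppt_imp_sep\<close> decomposes the resulting
    blocks.\<close>
  have summand: "\<exists>h. sepfun n h \<and> (\<forall>i<n. \<forall>j<n. \<forall>a<3. \<forall>b<3. h (3 * i + a, 3 * j + b) =
      of_real (ps ! k) * \<phi>1 (block3 (outer (as ! k)) i j) $$ (a, b))" if "k < length as" for k
  proof -
    have car: "as ! k \<in> carrier_vec (n * 3)" and "schmidt_rank_le n 3 2 (as ! k)" and p: "ps ! k \<ge> 0"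
      using as ps that len by auto
    then obtain x x' y y' where y: "y \<in> carrier_vec 3" "y' \<in> carrier_vec 3"
      and a: "\<And>i c. i < n \<Longrightarrow> c < 3 \<Longrightarrow> as ! k $\<^sub>v (3 * i + c) = x i * y $\<^sub>v c + x' i * y' $\<^sub>v c"
      by (metis schmidt_rank_le_2)
    note ppt = ppt_of_PPT_map[OF assms(1) y]
    \<comment> \<open>The weight is absorbed into the left factors through its square root.\<close>
    define s where "s = complex_of_real (sqrt (ps ! k))"
    have s: "s * cnj s = of_real (ps ! k)" using p by (simp add: s_def flip: of_real_mult)
    have s': "(s * z) * cnj (s * w) * q = of_real (ps ! k) * (z * cnj w * q)" for z w q
      by (simp add: s[symmetric])
    obtain h where h: "sepfun n h" "\<And>i j a b. i < n \<Longrightarrow> j < n \<Longrightarrow> a < 3 \<Longrightarrow> b < 3 \<Longrightarrow> h (3 * i + a, 3 * j + b) =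
        of_real (ps ! k) * (x i * cnj (x j) * \<phi>1 (ketbra y y) $$ (a, b) + x i * cnj (x' j) * \<phi>1 (ketbra y y') $$ (a, b)
        + x' i * cnj (x j) * \<phi>1 (ketbra y' y) $$ (a, b) + x' i * cnj (x' j) * \<phi>1 (ketbra y' y') $$ (a, b))"
      using sepfun_of_sep[OF ppt_imp_sep[OF ppt(1)], of n "\<lambda>i. s * x i" "\<lambda>i. s * x' i"]
      unfolding s' ppt(2)[symmetric] by (auto simp: to_matrix3_def ix3_the3 distrib_left)
    show ?thesis
      by (rule exI[of _ h]) (simp add: h linear_map3_block_outer[OF lin1 a car])
  qed
  then obtain h where h: "\<And>k. k < length as \<Longrightarrow> sepfun n (h k)"
    and hk: "\<And>k i j a b. k < length as \<Longrightarrow> i < n \<Longrightarrow> j < n \<Longrightarrow> a < 3 \<Longrightarrow> b < 3 \<Longrightarrow>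
      h k (3 * i + a, 3 * j + b) = of_real (ps ! k) * \<phi>1 (block3 (outer (as ! k)) i j) $$ (a, b)"
    by metis
  have entry: "id_tensor n \<phi>1 \<sigma> $$ (r, c) = (\<Sum>k<length as. h k (r, c))" if rc: "r < n * 3" "c < n * 3" for r c
  proof -
    define i j a b where "i = r div 3" and "j = c div 3" and "a = r mod 3" and "b = c mod 3"
    have ij: "i < n" "j < n" and ab: "a < 3" "b < 3"
      using rc by (simp_all add: i_def j_def a_def b_def less_mult_imp_div_less)
    have r: "r = 3 * i + a" "c = 3 * j + b" by (simp_all add: i_def j_def a_def b_def)
    have lt: "3 * i + e < n * 3" "3 * j + e < n * 3" if "e < 3" for e
      using ij that by linarith+
    have dim: "dim_vec (as ! k) = n * 3" if "k < length as" for k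
      using as that by auto
    have "block3 \<sigma> i j = Matrix.mat 3 3 (\<lambda>rc. \<Sum>k<length as. of_real (ps ! k) * block3 (outer (as ! k)) i j $$ rc)"
      unfolding block3_def \<sigma> using lt by (auto simp: outer_def dim intro!: eq_matI sum.cong)
    then have "\<phi>1 (block3 \<sigma> i j) $$ (a, b)
        = (\<Sum>k<length as. of_real (ps ! k) * \<phi>1 (block3 (outer (as ! k)) i j) $$ (a, b))"
      using linear_map3_sum[OF lin1 _ ab] by (simp add: block3_def)
    also have "\<dots> = (\<Sum>k<length as. h k (r, c))"
      unfolding r using hk ij ab by simp
    finally show ?thesis
      using rc by (simp add: id_tensor_def i_def j_def a_def b_def)
  qed
  show ?thesis
    unfolding out by (rule separableI[OF psd sepfun_sum[OF h] entry])
qed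

end
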